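(* Let $\mathbb{D}$ be the unit disc, and let $\Omega\subset\mathbb{C}$ be a bounded simply connected quadrature domain which is the image of a rational biholomorphic function $R:\mathbb{D}\to\Omega$ with the properties that $R(z)$ extends to be univalent in a neighborhood of $\overline{\mathbb{D}}$, and $R'(0)$ is not a real number. Then there exists a homotopy $\varphi_t(z)$, $0\le t\le1$, between the identity map on $\mathbb{D}$ and $R(z)$ (that is, $\varphi_0(z)=z$ and $\varphi_1(z)=R(z)$) such that each $\varphi_t$ is univalent on $\mathbb{D}$, and the image of $\mathbb{D}$ under each $\varphi_t$ is a quadrature domain. Such a homotopy may be chosen to be a continuous rescaling of the straight-line homotopy.
   Context: Univalent means holomorphic and injective. For a domain $\Omega\subset\mathbb{C}$, $H^2(\Omega)$ is the Bergman space of holomorphic functions on $\Omega$ square-integrable with respect to area measure. $\Omega$ is a quadrature domain (for $H^2$ functions) if there exist finitely many points $z_k\in\Omega$ and constants $c_{jk}$ (finitely many) with $\int_\Omega f\,dA=\sum_{j,k}c_{jk}f^{(j)}(z_k)$ for all $f\in H^2(\Omega)$. A homotopy is a map $(t,z)\mapsto\varphi_t(z)\in\mathbb{C}$ continuous on $[0,1]\times\mathbb{D}$. The straight-line homotopy is $f_t(z)=(1-t)z+tR(z)$; a continuous rescaling of it is a homotopy of the form $\varphi_t(z)=f_t(k(t)z)$ with $k:[0,1]\to(0,1]$ continuous. *)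

theory Defs
  imports "HOL-Complex_Analysis.Complex_Analysis"
begin

abbreviation unit_disc :: "complex set" where
  "unit_disc \<equiv> ball 0 1"

definition univalent_on :: "(complex \<Rightarrow> complex) \<Rightarrow> complex set \<Rightarrow> bool" where
  "univalent_on f S \<longleftrightarrow> f holomorphic_on S \<and> inj_on f S"

definition biholomorphic :: "(complex \<Rightarrow> complex) \<Rightarrow> complex set \<Rightarrow> complex set \<Rightarrow> bool" where
  "biholomorphic f S T \<longleftrightarrow>
     f holomorphic_on S \<and> bij_betw f S T \<and> inv_into S f holomorphic_on T"

text \<open>Any rational function without poles in \<open>S\<close> has, in lowest terms, a denominator
  that does not vanish on \<open>S\<close>.\<close>

definition rational_on :: "(complex \<Rightarrow> complex) \<Rightarrow> complex set \<Rightarrow> bool" where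
  "rational_on f S \<longleftrightarrow>
     (\<exists>p q :: complex poly. \<forall>z\<in>S. poly q z \<noteq> 0 \<and> f z = poly p z / poly q z)"

text \<open>Functions are total, so \<open>f\<close> may be arbitrary off \<open>S\<close> and its extension is a
  separate function \<open>g\<close>.\<close>

definition extends_univalently_near ::
    "(complex \<Rightarrow> complex) \<Rightarrow> complex set \<Rightarrow> complex set \<Rightarrow> bool" where
  "extends_univalently_near f S K \<longleftrightarrow>
     (\<exists>U g. open U \<and> K \<subseteq> U \<and> univalent_on g U \<and> (\<forall>z\<in>S. g z = f z))"

text \<open>On the type of complex numbers, \<^const>\<open>lborel\<close> is area measure.\<close>

definition bergman_space :: "complex set \<Rightarrow> (complex \<Rightarrow> complex) set" where
  "bergman_space \<Omega> =
     {f. f holomorphic_on \<Omega> \<and> set_integrable lborel \<Omega> (\<lambda>z. (cmod (f z))\<^sup>2)}"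

text \<open>Integrability of \<open>f\<close> is required explicitly because the Bochner integral of a
  non-integrable function is 0 by convention; it is automatic when \<open>\<Omega>\<close> has finite area.
  The derivatives at the different nodes may be taken up to a common order \<open>N\<close>, since
  coefficients may be 0.\<close>

definition quadrature_domain :: "complex set \<Rightarrow> bool" where
  "quadrature_domain \<Omega> \<longleftrightarrow>
     open \<Omega> \<and> connected \<Omega> \<and> \<Omega> \<noteq> {} \<and>
     (\<exists>Z (N :: nat) (c :: nat \<Rightarrow> complex \<Rightarrow> complex). finite Z \<and> Z \<subseteq> \<Omega> \<and>
        (\<forall>f\<in>bergman_space \<Omega>.
           set_integrable lborel \<Omega> f \<and>
           set_lebesgue_integral lborel \<Omega> f =
             (\<Sum>z\<in>Z. \<Sum>j\<le>N. c j z * (deriv ^^ j) f z)))"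

definition homotopy_between ::
    "complex set \<Rightarrow> (real \<Rightarrow> complex \<Rightarrow> complex) \<Rightarrow>
     (complex \<Rightarrow> complex) \<Rightarrow> (complex \<Rightarrow> complex) \<Rightarrow> bool" where
  "homotopy_between S \<phi> f g \<longleftrightarrow>
     continuous_on ({0..1} \<times> S) (\<lambda>(t, z). \<phi> t z) \<and>
     (\<forall>z\<in>S. \<phi> 0 z = f z) \<and> (\<forall>z\<in>S. \<phi> 1 z = g z)"

definition straight_line :: "(complex \<Rightarrow> complex) \<Rightarrow> real \<Rightarrow> complex \<Rightarrow> complex" where
  "straight_line R t z = (1 - of_real t) * z + of_real t * R z"

definition rescaling_of_straight_line ::
    "(complex \<Rightarrow> complex) \<Rightarrow> (real \<Rightarrow> complex \<Rightarrow> complex) \<Rightarrow> bool" where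
  "rescaling_of_straight_line R \<phi> \<longleftrightarrow>
     (\<exists>k :: real \<Rightarrow> real. continuous_on {0..1} k \<and> k ` {0..1} \<subseteq> {0<..1} \<and>
        (\<forall>t\<in>{0..1}. \<forall>z\<in>unit_disc. \<phi> t z = straight_line R t (of_real (k t) * z)))"

end

theory Submission
  imports Defs "HOL-Computational_Algebra.Fundamental_Theorem_Algebra"
begin

text \<open>
  Write \<open>f\<^sub>t z = (1 - t) * z + t * R z\<close>. For \<open>t\<close> near 0 and near 1 the map \<open>f\<^sub>t\<close> is injective on the
  whole disc, because \<open>R\<close> is Lipschitz and, being univalent near the closed disc, also
  bounded below by a multiple of the distance. For the remaining \<open>t\<close> the derivative
  \<open>f\<^sub>t'(0) = (1 - t) + t * R'(0)\<close> is bounded away from 0, as \<open>R'(0)\<close> is not real, so \<open>f\<^sub>t\<close> is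
  injective on a disc of a fixed radius \<open>r\<close>. Hence \<open>k\<close> may descend from 1 to \<open>r\<close> and return.

  The image of the disc under an injective rational \<open>F\<close> without poles on the closed disc is
  a quadrature domain. With \<open>H = (h \<circ> F) * F'\<close>, the integral of \<open>h\<close> over the image is the integral
  of \<open>H * cnj F'\<close> over the disc. By orthogonality of powers this equals a constant times the
  integral of \<open>H z * cnj (F (1 / cnj z))\<close> over a circle of radius slightly less than 1. There
  \<open>cnj (F (1 / cnj z))\<close> is a rational function of \<open>z\<close> with all its poles inside the circle, so the
  value only depends on finitely many derivatives of \<open>H\<close>, and hence of \<open>h\<close>, at finitely many
  points.
\<close>

section \<open>Conformal change of variables\<close>

text \<open>The change of variables formula \<open>has_absolute_integral_change_of_variables\<close>
  speaks of maps of \<open>real^'n\<close>. This map and its inverse \<open>vec_of_complex\<close>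
  carry domains and values between the two models of the plane.\<close>

definition complex_of_vec :: "real^2 \<Rightarrow> complex" where
  "complex_of_vec v = Complex (v $ 1) (v $ 2)"

definition vec_of_complex :: "complex \<Rightarrow> real^2" where
  "vec_of_complex z = (\<chi> i. if i = 1 then Re z else Im z)"

lemma complex_of_vec_inverse [simp]: "vec_of_complex (complex_of_vec v) = v"
  by (auto simp: complex_of_vec_def vec_of_complex_def vec_eq_iff forall_2)

lemma vec_of_complex_inverse [simp]: "complex_of_vec (vec_of_complex z) = z"
  by (simp add: complex_of_vec_def vec_of_complex_def)

lemma bounded_linear_complex_of_vec: "bounded_linear complex_of_vec"
  by (rule linear_linear[THEN iffD2], rule linearI) (auto simp: complex_of_vec_def complex_eq_iff)

lemma bounded_linear_vec_of_complex: "bounded_linear vec_of_complex"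
  by (rule linear_linear[THEN iffD2], rule linearI) (auto simp: vec_of_complex_def vec_eq_iff)

lemmas continuous_on_complex_of_vec =
  linear_continuous_on[OF bounded_linear_complex_of_vec]
lemmas continuous_on_vec_of_complex =
  linear_continuous_on[OF bounded_linear_vec_of_complex]

text \<open>Lebesgue measure is determined by its values on boxes, and the preimage of a box is the
  box with the same side lengths.\<close>

lemma distr_lborel_complex_of_vec: "distr lborel borel complex_of_vec = lborel"
proof (rule lborel_eqI[symmetric])
  fix l u :: complex
  assume le: "\<And>b. b \<in> Basis \<Longrightarrow> l \<bullet> b \<le> u \<bullet> b"
  have [measurable]: "complex_of_vec \<in> borel_measurable borel"
    by (intro borel_measurable_continuous_onI continuous_on_complex_of_vec)
  have box: "complex_of_vec -` box l u = box (vec_of_complex l) (vec_of_complex u)"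
    by (auto simp: complex_of_vec_def vec_of_complex_def box_def Basis_complex_def
        mem_box_cart Basis_vec_def inner_axis forall_2)
  have "Re l \<le> Re u" "Im l \<le> Im u"
    using le[of 1] le[of \<i>] by (auto simp: Basis_complex_def)
  then show "emeasure (distr lborel borel complex_of_vec) (box l u) = (\<Prod>b\<in>Basis. (u - l) \<bullet> b)"
    by (subst emeasure_distr)
       (auto simp: box emeasure_lborel_box_eq Basis_vec_def Basis_complex_def inner_axis
          vec_of_complex_def UNIV_2 axis_eq_axis)
qed simp

text \<open>Bridge between the Bochner integral on the complex plane and the gauge integral on
  \<open>real^2\<close>. Continuity on an open set makes the function extended by 0 Borel
  measurable, so passing from \<open>lborel\<close> to its completion changes nothing.\<close>

lemma
  fixes h :: "complex \<Rightarrow> complex"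
  assumes "open T" "continuous_on T h"
  shows set_integrable_complex_iff_vec: "set_integrable lborel T h \<longleftrightarrow>
           (\<lambda>v. vec_of_complex (h (complex_of_vec v))) absolutely_integrable_on vec_of_complex ` T"
    and set_lebesgue_integral_complex_eq_vec: "set_integrable lborel T h \<Longrightarrow> 
           vec_of_complex (set_lebesgue_integral lborel T h) =
           integral (vec_of_complex ` T) (\<lambda>v. vec_of_complex (h (complex_of_vec v)))"
proof -
  have T: "vec_of_complex ` T = complex_of_vec -` T"
    by (auto simp: image_iff) (metis complex_of_vec_inverse)
  have phi[measurable]: "complex_of_vec \<in> borel_measurable borel"
    by (intro borel_measurable_continuous_onI continuous_on_complex_of_vec)
  have psi[measurable]: "vec_of_complex \<in> borel_measurable borel"
    by (intro borel_measurable_continuous_onI continuous_on_vec_of_complex)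
  define F where "F = (\<lambda>z. indicator T z *\<^sub>R h z)"
  have F[measurable]: "F \<in> borel_measurable borel"
    unfolding F_def using assms by (intro borel_measurable_continuous_on_indicator) auto
  interpret psi: bounded_linear vec_of_complex by (rule bounded_linear_vec_of_complex)
  have G: "indicator (vec_of_complex ` T) v *\<^sub>R vec_of_complex (h (complex_of_vec v))
      = vec_of_complex (F (complex_of_vec v))" for v
    by (auto simp: F_def T indicator_def)
  have 1: "integrable lborel F \<longleftrightarrow> integrable lborel (\<lambda>v. F (complex_of_vec v))"
    by (subst distr_lborel_complex_of_vec[symmetric], subst integrable_distr_eq) auto
  also have "\<dots> \<longleftrightarrow> integrable lborel (\<lambda>v. vec_of_complex (F (complex_of_vec v)))"
    using integrable_bounded_linear[OF bounded_linear_vec_of_complex, of lborel "\<lambda>v. F (complex_of_vec v)"]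
      integrable_bounded_linear[OF bounded_linear_complex_of_vec, of lborel "\<lambda>v. vec_of_complex (F (complex_of_vec v))"]
    by auto
  also have "\<dots> \<longleftrightarrow> integrable lebesgue (\<lambda>v. vec_of_complex (F (complex_of_vec v)))"
    by (rule integrable_completion[symmetric]) measurable
  finally show iff: "set_integrable lborel T h \<longleftrightarrow>
           (\<lambda>v. vec_of_complex (h (complex_of_vec v))) absolutely_integrable_on vec_of_complex ` T"
    unfolding set_integrable_def G F_def[symmetric] .
  assume int: "set_integrable lborel T h"
  then have int': "integrable lborel F" by (simp add: set_integrable_def F_def)
  have "vec_of_complex (set_lebesgue_integral lborel T h) = vec_of_complex (integral\<^sup>L lborel F)"
    by (simp add: set_lebesgue_integral_def F_def)
  also have "integral\<^sup>L lborel F = integral\<^sup>L lborel (\<lambda>v. F (complex_of_vec v))"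
    by (subst distr_lborel_complex_of_vec[symmetric], subst integral_distr) auto
  also have "vec_of_complex \<dots> = integral\<^sup>L lborel (\<lambda>v. vec_of_complex (F (complex_of_vec v)))"
    using 1 int' by (intro integral_bounded_linear[symmetric, OF bounded_linear_vec_of_complex]) auto
  also have "\<dots> = integral\<^sup>L lebesgue (\<lambda>v. vec_of_complex (F (complex_of_vec v)))"
    by (rule integral_completion[symmetric]) measurable
  also have "\<dots> = set_lebesgue_integral lebesgue (vec_of_complex ` T) (\<lambda>v. vec_of_complex (h (complex_of_vec v)))"
    unfolding set_lebesgue_integral_def G ..
  also have "\<dots> = integral (vec_of_complex ` T) (\<lambda>v. vec_of_complex (h (complex_of_vec v)))"
    using int iff by (intro set_lebesgue_integral_eq_integral) auto
  finally show "vec_of_complex (set_lebesgue_integral lborel T h) =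
           integral (vec_of_complex ` T) (\<lambda>v. vec_of_complex (h (complex_of_vec v)))" .
qed

text \<open>As a real map, a holomorphic function has Jacobian determinant |f'|^2; the rest is
  transport of the real change of variables theorem to the complex plane.\<close>

lemma
  fixes f h :: "complex \<Rightarrow> complex"
  assumes S: "open S" and f: "f holomorphic_on S" "inj_on f S" and h: "continuous_on (f ` S) h"
  shows set_integrable_conformal: "set_integrable lborel (f ` S) h \<longleftrightarrow>
           set_integrable lborel S (\<lambda>z. of_real ((cmod (deriv f z))\<^sup>2) * h (f z))"
    and set_lebesgue_integral_conformal: "set_integrable lborel (f ` S) h \<Longrightarrow> 
           set_lebesgue_integral lborel (f ` S) h =
           set_lebesgue_integral lborel S (\<lambda>z. of_real ((cmod (deriv f z))\<^sup>2) * h (f z))"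
proof -
  define S' where "S' = vec_of_complex ` S"
  define G where "G = (\<lambda>v. vec_of_complex (f (complex_of_vec v)))"
  define G' where "G' = (\<lambda>v w. vec_of_complex (deriv f (complex_of_vec v) * complex_of_vec w))"
  define H where "H = (\<lambda>v. vec_of_complex (h (complex_of_vec v)))"
  define k where "k = (\<lambda>z. of_real ((cmod (deriv f z))\<^sup>2) * h (f z))"
  have S': "S' = complex_of_vec -` S"
    unfolding S'_def by (auto simp: image_iff) (metis complex_of_vec_inverse)
  have oS': "open S'"
    unfolding S' by (rule open_vimage[OF S continuous_on_complex_of_vec])
  have ofS: "open (f ` S)"
    using open_mapping_thm3[OF f(1) S f(2)] .
  have k: "continuous_on S k"
    unfolding k_def using h f S
    by (intro continuous_intros holomorphic_on_imp_continuous_on holomorphic_deriv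
         continuous_on_compose2[OF h]) auto
  have GS: "G ` S' = vec_of_complex ` (f ` S)"
    by (auto simp: G_def S'_def image_image)
  have "inj_on G S'"
    using f(2) unfolding G_def S' inj_on_def by (metis complex_of_vec_inverse vec_of_complex_inverse vimageE)
  have der: "(G has_derivative G' v) (at v within S')" if "v \<in> S'" for v
  proof -
    have "complex_of_vec v \<in> S" using that S' by auto
    then have "(f has_derivative (\<lambda>w. deriv f (complex_of_vec v) * w)) (at (complex_of_vec v))"
      using f(1) S by (metis has_field_derivative_def holomorphic_derivI)
    moreover have "(complex_of_vec has_derivative complex_of_vec) (at v)"
      by (rule bounded_linear_imp_has_derivative[OF bounded_linear_complex_of_vec])
    ultimately have "((\<lambda>v. f (complex_of_vec v)) has_derivative
        (\<lambda>w. deriv f (complex_of_vec v) * complex_of_vec w)) (at v)"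
      by (rule has_derivative_compose[rotated])
    from bounded_linear.has_derivative[OF bounded_linear_vec_of_complex this] show ?thesis
      unfolding G_def G'_def by (rule has_derivative_at_withinI)
  qed
  \<comment> \<open>Multiplication by a + bi has the real matrix with rows (a, -b) and (b, a), of
    determinant a^2 + b^2.\<close>
  have det: "\<bar>det (matrix (G' v))\<bar> = (cmod (deriv f (complex_of_vec v)))\<^sup>2" for v
    by (simp add: det_2 matrix_def G'_def vec_of_complex_def complex_of_vec_def axis_def
          cmod_power2) (simp add: power2_eq_square)
  interpret psi: bounded_linear vec_of_complex by (rule bounded_linear_vec_of_complex)
  have eq: "\<bar>det (matrix (G' v))\<bar> *\<^sub>R H (G v) = vec_of_complex (k (complex_of_vec v))" for v
    unfolding det H_def G_def k_def psi.scaleR[symmetric]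
    by (simp only: scaleR_conv_of_real vec_of_complex_inverse)
  have "S' \<in> sets lebesgue"
    using oS' by (intro sets_completionI_sets) simp
  then have *: "(\<lambda>v. vec_of_complex (k (complex_of_vec v))) absolutely_integrable_on S' \<and>
             integral S' (\<lambda>v. vec_of_complex (k (complex_of_vec v))) = b
     \<longleftrightarrow> H absolutely_integrable_on (vec_of_complex ` f ` S) \<and> integral (vec_of_complex ` f ` S) H = b" for b
    using has_absolute_integral_change_of_variables[of S' G G' H b] der \<open>inj_on G S'\<close>
    unfolding eq GS by blast
  note ifh = set_integrable_complex_iff_vec[OF ofS h, folded H_def]
  note ik = set_integrable_complex_iff_vec[OF S k, folded S'_def]
  \<comment> \<open>The value \<open>b\<close> in \<open>*\<close> is arbitrary; taking the integral
    itself for \<open>b\<close> leaves a statement about integrability alone.\<close>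
  have **: "set_integrable lborel (f ` S) h \<longleftrightarrow> set_integrable lborel S k"
    unfolding ifh ik
    using *[THEN iffD1, OF conjI[OF _ refl]] *[THEN iffD2, OF conjI[OF _ refl]] by iprover
  then show "set_integrable lborel (f ` S) h \<longleftrightarrow>
           set_integrable lborel S (\<lambda>z. of_real ((cmod (deriv f z))\<^sup>2) * h (f z))"
    unfolding k_def .
  assume int: "set_integrable lborel (f ` S) h"
  then have int': "set_integrable lborel S k" using ** by simp
  have "vec_of_complex (set_lebesgue_integral lborel (f ` S) h) = integral (vec_of_complex ` f ` S) H"
    using set_lebesgue_integral_complex_eq_vec[OF ofS h int, folded H_def] .
  also have "\<dots> = integral S' (\<lambda>v. vec_of_complex (k (complex_of_vec v)))"
    using *[THEN iffD1, OF conjI[OF _ refl]] int'[unfolded ik] by simp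
  also have "\<dots> = vec_of_complex (set_lebesgue_integral lborel S k)"
    using set_lebesgue_integral_complex_eq_vec[OF S k int', folded S'_def] by simp
  finally show "set_lebesgue_integral lborel (f ` S) h =
           set_lebesgue_integral lborel S (\<lambda>z. of_real ((cmod (deriv f z))\<^sup>2) * h (f z))"
    unfolding k_def by (metis vec_of_complex_inverse)
qed

section \<open>Polar coordinates on the disc\<close>

text \<open>Again a comparison on boxes, this time with the product measure, which makes Fubini
  available in real and imaginary part.\<close>

lemma distr_lborel_Complex: "distr (lborel \<Otimes>\<^sub>M lborel) borel (\<lambda>(x, y). Complex x y) = lborel"
proof (rule lborel_eqI[symmetric])
  fix l u :: complex
  assume le: "\<And>b. b \<in> Basis \<Longrightarrow> l \<bullet> b \<le> u \<bullet> b"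
  have [measurable]: "(\<lambda>(x, y). Complex x y) \<in> borel_measurable borel"
    by (intro borel_measurable_continuous_onI) (auto simp: case_prod_beta Complex_eq intro!: continuous_intros)
  have box: "(\<lambda>(x, y). Complex x y) -` box l u = box (Re l, Im l) (Re u, Im u)"
    by (auto simp: box_def Basis_complex_def Basis_prod_def)
  have "Re l \<le> Re u" "Im l \<le> Im u"
    using le[of 1] le[of \<i>] by (auto simp: Basis_complex_def)
  then show "emeasure (distr (lborel \<Otimes>\<^sub>M lborel) borel (\<lambda>(x, y). Complex x y)) (box l u) = (\<Prod>b\<in>Basis. (u - l) \<bullet> b)"
    unfolding lborel_prod
    by (subst emeasure_distr)
       (auto simp: box emeasure_lborel_box_eq Basis_complex_def Basis_prod_def)
qed simp

text \<open>The real axis is a hyperplane, hence null. This permits removing the slit along which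
  polar coordinates are cut.\<close>

lemma AE_complex_Im_nonzero: "AE z in lborel. Im z \<noteq> 0"
proof -
  have "negligible {z. \<i> \<bullet> z = 0}"
    by (rule negligible_hyperplane) simp
  then have "{z. Im z = 0} \<in> null_sets lebesgue"
    by (simp add: negligible_iff_null_sets)
  moreover have "{z. Im z = 0} \<in> sets lborel"
    by (simp add: borel_closed closed_Collect_eq continuous_intros)
  ultimately have "{z. Im z = 0} \<in> null_sets lborel"
    by (simp add: null_sets_completion_iff)
  then show ?thesis by (rule AE_I') auto
qed

text \<open>The radial integral that remains in polar coordinates once the radius is written as exp
  x with x < 0.\<close>

lemma set_lebesgue_integral_exp_lessThan:
  fixes a :: real
  assumes "a > 0"
  shows "(LBINT x:{..<0}. exp (a * x)) = 1 / a"
proof -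
  have lim: "((\<lambda>x. - exp (- a * x) / a) \<longlongrightarrow> 0) at_top"
    using assms by real_asymp
  have nn: "(\<integral>\<^sup>+x. ennreal (exp (- a * x)) * indicator {0..} x \<partial>lborel) = 0 - (- exp (- a * 0) / a)"
    using assms by (intro nn_integral_FTC_atLeast[OF _ _ _ lim]) (auto intro!: derivative_eq_intros)
  have "has_bochner_integral lborel (\<lambda>x. exp (- a * x) * indicator {0..} x) (1 / a)"
  proof (rule has_bochner_integral_nn_integral)
    show "(\<integral>\<^sup>+x. ennreal (exp (- a * x) * indicator {0..} x) \<partial>lborel) = ennreal (1 / a)"
      using nn by (simp add: ennreal_mult'' ennreal_indicator)
  qed (use assms in auto)
  then have "(\<integral>x. exp (- a * x) * indicator {0..} x \<partial>lborel) = 1 / a"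
    by (rule has_bochner_integral_integral_eq)
  moreover have "(LBINT x:{..<0}. exp (a * x)) = (\<integral>x. exp (- a * x) * indicator {0<..} x \<partial>lborel)"
    unfolding set_lebesgue_integral_def
    by (subst lborel_integral_real_affine[where c = "-1" and t = 0])
       (auto simp: indicator_def intro!: Bochner_Integration.integral_cong)
  moreover have "(\<integral>x. exp (- a * x) * indicator {0<..} x \<partial>lborel) = (\<integral>x. exp (- a * x) * indicator {0..} x \<partial>lborel)"
    by (rule integral_cong_AE) (auto intro: AE_mp[OF AE_lborel_singleton[of 0]] simp: indicator_def)
  ultimately show ?thesis by simp
qed

text \<open>The half-strip that \<open>exp\<close> maps injectively onto the unit disc slit along
  the nonnegative reals. Polar coordinates thus become a case of the conformal change of variables,
  with Re w the logarithm of the radius and Im w the angle.\<close>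

definition log_strip :: "complex set" where
  "log_strip = {w. Re w < 0 \<and> 0 < Im w \<and> Im w < 2 * pi}"

lemma open_log_strip: "open log_strip"
  unfolding log_strip_def
  by (intro open_Collect_conj open_Collect_less continuous_intros)

lemma inj_on_exp_log_strip: "inj_on exp log_strip"
  by (rule inj_onI, rule exp_complex_eqI) (auto simp: log_strip_def abs_if)

lemma exp_log_strip: "exp ` log_strip = ball 0 1 - {z. Im z = 0 \<and> 0 \<le> Re z}"
proof (intro equalityI subsetI)
  fix z assume "z \<in> exp ` log_strip"
  then obtain w where w: "z = exp w" "Re w < 0" "0 < Im w" "Im w < 2 * pi"
    by (auto simp: log_strip_def)
  have False if "Im z = 0" "0 \<le> Re z"
  proof -
    have "sin (Im w) = 0" "0 \<le> cos (Im w)"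
      using that w(1) by (auto simp: Im_exp Re_exp zero_le_mult_iff)
    moreover from this(1) have "Im w = pi"
      using w(3,4) sin_zero_iff_int2 sin_gt_zero[of "Im w"] sin_lt_zero[of "Im w"] by fastforce
    ultimately show False by simp
  qed
  with w show "z \<in> ball 0 1 - {z. Im z = 0 \<and> 0 \<le> Re z}" by auto
next
  fix z :: complex assume z: "z \<in> ball 0 1 - {z. Im z = 0 \<and> 0 \<le> Re z}"
  then have "z \<noteq> 0" by auto
  \<comment> \<open>\<open>Arg2pi\<close> takes values in [0, 2 pi) and is 0 exactly on the removed
    slit, so the angle is strictly positive here.\<close>
  define w where "w = Complex (ln (cmod z)) (Arg2pi z)"
  have "exp w = z"
    using Arg2pi_eq[of z] \<open>z \<noteq> 0\<close>
    by (simp add: w_def Complex_eq exp_add exp_of_real mult.commute)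
  moreover have "Re w < 0" using z \<open>z \<noteq> 0\<close> by (simp add: w_def)
  moreover have "0 < Im w" "Im w < 2 * pi"
    using Arg2pi_ge_0[of z] Arg2pi_lt_2pi[of z] Arg2pi_eq_0[of z] z
    by (auto simp: w_def complex_is_Real_iff less_le)
  ultimately show "z \<in> exp ` log_strip" by (auto simp: log_strip_def intro!: image_eqI[of _ _ w])
qed

text \<open>The slit is null, so the disc may be replaced by the conformal image of
  \<open>log_strip\<close> under \<open>exp\<close>. The Jacobian |exp w|^2 is exp (2 x), and Fubini
  separates logarithmic radius and angle.\<close>

lemma set_lebesgue_integral_polar:
  fixes h :: "complex \<Rightarrow> complex"
  assumes h: "continuous_on (ball 0 1) h" and int: "set_integrable lborel (ball 0 1) h"
  shows "set_lebesgue_integral lborel (ball 0 1) h =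
     (LBINT x:{..<0}. LBINT y:{0<..<2*pi}. of_real (exp (2 * x)) * h (of_real (exp x) * cis y))"
proof -
  define F where "F = (\<lambda>w. indicator log_strip w *\<^sub>R (of_real ((cmod (deriv exp w))\<^sup>2) * h (exp w)))"
  have sub: "exp ` log_strip \<subseteq> ball 0 1" by (auto simp: exp_log_strip)
  have op: "open (exp ` log_strip)"
    by (rule open_mapping_thm3[OF _ open_log_strip inj_on_exp_log_strip]) (intro holomorphic_intros)
  have int': "set_integrable lborel (exp ` log_strip) h"
    using int by (rule set_integrable_subset) (use op sub in auto)
  have hc: "continuous_on (exp ` log_strip) h" using h sub by (rule continuous_on_subset)
  note change = open_log_strip holomorphic_on_exp inj_on_exp_log_strip hc
  have F: "integrable lborel F"
    using int' set_integrable_conformal[OF change] by (simp add: F_def set_integrable_def)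
  have [measurable]: "(\<lambda>(x, y). Complex x y) \<in> borel_measurable (lborel \<Otimes>\<^sub>M lborel)"
    unfolding lborel_prod measurable_lborel2 
    by (intro borel_measurable_continuous_onI) (auto simp: case_prod_beta Complex_eq intro!: continuous_intros)
  have [measurable]: "F \<in> borel_measurable borel" using F by auto
  have F': "integrable (lborel \<Otimes>\<^sub>M lborel) (\<lambda>(x, y). F (Complex x y))"
    using F by (subst (asm) distr_lborel_Complex[symmetric], subst (asm) integrable_distr_eq) (auto simp: case_prod_beta')
  have "set_lebesgue_integral lborel (ball 0 1) h = set_lebesgue_integral lborel (exp ` log_strip) h"
    unfolding set_lebesgue_integral_def
  proof (rule integral_cong_AE)
    show "AE z in lborel. indicator (ball 0 1) z *\<^sub>R h z = indicator (exp ` log_strip) z *\<^sub>R h z"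
      using AE_complex_Im_nonzero by eventually_elim (auto simp: exp_log_strip indicator_def)
  qed (use int int' in \<open>auto simp: set_integrable_def\<close>)
  also have "\<dots> = integral\<^sup>L lborel F"
    using set_lebesgue_integral_conformal[OF change int'] by (simp add: F_def set_lebesgue_integral_def)
  also have "\<dots> = (\<integral>(x, y). F (Complex x y) \<partial>(lborel \<Otimes>\<^sub>M lborel))"
    by (subst distr_lborel_Complex[symmetric], subst integral_distr) (auto simp: case_prod_beta')
  also have "\<dots> = (\<integral>x. \<integral>y. F (Complex x y) \<partial>lborel \<partial>lborel)"
    using lborel_pair.integral_fst'[OF F'] by simp
  also have "\<dots> = (LBINT x:{..<0}. LBINT y:{0<..<2*pi}. of_real (exp (2 * x)) * h (of_real (exp x) * cis y))"
    unfolding set_lebesgue_integral_def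
  proof (intro Bochner_Integration.integral_cong refl)
    fix x :: real
    have "F (Complex x y) = indicator {..<0} x *\<^sub>R indicator {0<..<2*pi} y *\<^sub>R (of_real (exp (2 * x)) * h (of_real (exp x) * cis y))" for y
      by (auto simp: F_def log_strip_def indicator_def DERIV_imp_deriv[OF DERIV_exp] exp_eq_polar norm_mult power2_eq_square exp_double)
    then show "(\<integral>y. F (Complex x y) \<partial>lborel) = indicator {..<0} x *\<^sub>R
       (\<integral>y. indicator {0<..<2*pi} y *\<^sub>R (of_real (exp (2 * x)) * h (of_real (exp x) * cis y)) \<partial>lborel)"
      by (simp only: integral_scaleR_right)
  qed
  finally show ?thesis .
qed

text \<open>On the circle of radius r the conjugate of z is r^2 / z, so the integral is Cauchy's
  formula for the derivative of order \<open>m\<close>.\<close>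

lemma circle_integral_cnj_power:
  assumes H: "H holomorphic_on ball 0 1" and r: "0 < r" "r < 1"
  shows "(LBINT y:{0<..<2*pi}. H (of_real r * cis y) * cnj (of_real r * cis y) ^ m) =
     of_real (2 * pi * r ^ (2 * m)) * ((deriv ^^ m) H 0 / fact m)"
proof -
  let ?z = "\<lambda>y. of_real r * cis y"
  let ?f = "\<lambda>y. H (?z y) * cnj (?z y) ^ m"
  have Hc: "continuous_on (ball 0 1) H" using H by (rule holomorphic_on_imp_continuous_on)
  have "((\<lambda>u. H u / (u - 0) ^ Suc m) has_contour_integral (2 * pi * \<i> / fact m * (deriv ^^ m) H 0)) (circlepath 0 r)"
    using r by (intro Cauchy_has_contour_integral_higher_derivative_circlepath
        continuous_on_subset[OF Hc] holomorphic_on_subset[OF H]) auto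
  then have "((\<lambda>y. H (?z y) / ?z y ^ Suc m * of_real r * \<i> * cis y) has_integral
      (2 * pi * \<i> / fact m * (deriv ^^ m) H 0)) {0..2*pi}"
    unfolding circlepath_def by (subst (asm) has_contour_integral_part_circlepath_iff) auto
  \<comment> \<open>On the circle dz = i z dy. The factor -i removes the i, and r^(2m) turns 1 / z^m
    into the power of the conjugate.\<close>
  then have "((\<lambda>y. - \<i> * of_real (r ^ (2 * m)) * (H (?z y) / ?z y ^ Suc m * of_real r * \<i> * cis y)) has_integral
      (- \<i> * of_real (r ^ (2 * m)) * (2 * pi * \<i> / fact m * (deriv ^^ m) H 0))) {0..2*pi}"
    by (rule has_integral_mult_right)
  moreover have "- \<i> * of_real (r ^ (2 * m)) * (H (?z y) / ?z y ^ Suc m * of_real r * \<i> * cis y) = ?f y" for y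
  proof -
    have "?z y * cnj (?z y) = of_real (r\<^sup>2)"
      by (simp add: power2_eq_square cis_cnj cis_mult)
    then have "?z y ^ m * cnj (?z y) ^ m = of_real (r ^ (2 * m))"
      by (simp add: power_mult flip: power_mult_distrib of_real_power)
    then have "cnj (?z y) ^ m = of_real (r ^ (2 * m)) / ?z y ^ m"
      using r by (simp add: field_simps)
    then show ?thesis using r by (simp add: field_simps)
  qed
  moreover have "- \<i> * of_real (r ^ (2 * m)) * (2 * pi * \<i> / fact m * (deriv ^^ m) H 0)
     = of_real (2 * pi * r ^ (2 * m)) * ((deriv ^^ m) H 0 / fact m)"
    by (simp add: algebra_simps)
  ultimately have "(?f has_integral of_real (2 * pi * r ^ (2 * m)) * ((deriv ^^ m) H 0 / fact m)) {0..2*pi}"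
    by (simp only:)
  then have *: "(?f has_integral of_real (2 * pi * r ^ (2 * m)) * ((deriv ^^ m) H 0 / fact m)) {0<..<2*pi}"
    by (simp only: has_integral_Icc_iff_Ioo)
  have "continuous_on {0..2*pi} ?f"
    using r by (intro continuous_intros continuous_on_compose2[OF Hc]) (auto simp: norm_mult)
  then have "set_integrable lborel {0<..<2*pi} ?f"
    by (intro set_integrable_subset[OF borel_integrable_atLeastAtMost']) auto
  from set_borel_integral_eq_integral(2)[OF this] * show ?thesis
    by (simp add: integral_unique)
qed

lemma set_integrable_mult_bounded:
  fixes H g :: "complex \<Rightarrow> complex"
  assumes H: "set_integrable lborel S H" and S: "S \<in> sets borel" and g: "continuous_on S g"
    and K: "\<And>z. z \<in> S \<Longrightarrow> cmod (g z) \<le> K"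
  shows "set_integrable lborel S (\<lambda>z. H z * g z)"
  unfolding set_integrable_def
proof (rule Bochner_Integration.integrable_bound)
  show "integrable lborel (\<lambda>z. K *\<^sub>R (indicator S z *\<^sub>R H z))"
    using H unfolding set_integrable_def by (rule integrable_scaleR_right)
  have "(\<lambda>z. (indicator S z *\<^sub>R H z) * (indicator S z *\<^sub>R g z)) \<in> borel_measurable lborel"
    using H borel_measurable_continuous_on_indicator[OF S g]
    by (intro borel_measurable_times) (auto simp: set_integrable_def)
  also have "(\<lambda>z. (indicator S z *\<^sub>R H z) * (indicator S z *\<^sub>R g z)) = (\<lambda>z. indicator S z *\<^sub>R (H z * g z))"
    by (auto simp: indicator_def)
  finally show "(\<lambda>z. indicator S z *\<^sub>R (H z * g z)) \<in> borel_measurable lborel" .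
  show "AE z in lborel. norm (indicator S z *\<^sub>R (H z * g z)) \<le> norm (K *\<^sub>R (indicator S z *\<^sub>R H z))"
    using K by (intro AE_I2)
      (auto simp: indicator_def norm_mult mult.commute[of "cmod (H _)"] intro!: mult_right_mono order_trans[OF _ abs_ge_self])
qed

text \<open>Orthogonality of powers: in polar coordinates the angular integral picks the Taylor
  coefficient of order \<open>m\<close>, and the radial one supplies the factor 1 / (2m +
  2).\<close>

lemma disc_integral_cnj_power:
  assumes H: "H holomorphic_on ball 0 1" and int: "set_integrable lborel (ball 0 1) H"
  shows "(CLBINT z:ball 0 1. H z * cnj z ^ m) = of_real (pi / real (Suc m)) * ((deriv ^^ m) H 0 / fact m)"
proof -
  have Hc: "continuous_on (ball 0 1) H" using H by (rule holomorphic_on_imp_continuous_on)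
  let ?h = "\<lambda>z. H z * cnj z ^ m"
  let ?a = "(deriv ^^ m) H 0 / fact m"
  have h: "continuous_on (ball 0 1) ?h" by (intro continuous_intros Hc)
  have int': "set_integrable lborel (ball 0 1) ?h"
    using int by (rule set_integrable_mult_bounded[where K = 1])
      (auto simp: norm_power intro!: continuous_intros power_le_one)
  have inner: "(LBINT y:{0<..<2*pi}. of_real (exp (2 * x)) * ?h (of_real (exp x) * cis y)) =
     of_real (exp (real (2 * m + 2) * x)) * (of_real (2 * pi) * ?a)" if "x < 0" for x :: real
  proof -
    \<comment> \<open>Of the exponent 2m + 2, the part 2 is the area element and the part 2m comes
      from the circle formula.\<close>
    have "exp (2 * x) * exp x ^ (2 * m) = exp (real (2 * m + 2) * x)"
      by (simp add: algebra_simps flip: exp_of_nat_mult exp_add)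
    then show ?thesis
      using circle_integral_cnj_power[OF H, of "exp x" m] that
      by (simp flip: of_real_mult)
  qed
  have "(CLBINT z:ball 0 1. ?h z) =
     (LBINT x:{..<0}. LBINT y:{0<..<2*pi}. of_real (exp (2 * x)) * ?h (of_real (exp x) * cis y))"
    by (rule set_lebesgue_integral_polar[OF h int'])
  also have "\<dots> = (LBINT x:{..<0}. of_real (exp (real (2 * m + 2) * x)) * (of_real (2 * pi) * ?a))"
    by (rule set_lebesgue_integral_cong) (simp, intro allI impI, rule inner, simp)
  also have "\<dots> = of_real (LBINT x:{..<0}. exp (real (2 * m + 2) * x)) * (of_real (2 * pi) * ?a)"
    by (simp only: set_integral_mult_left set_integral_complex_of_real)
  also have "\<dots> = of_real (pi / real (Suc m)) * ?a"
  proof (subst set_lebesgue_integral_exp_lessThan)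
    have "1 / real (2 * m + 2) * (2 * pi) = pi / real (Suc m)"
      by (simp add: divide_simps)
    then show "of_real (1 / real (2 * m + 2)) * (of_real (2 * pi) * ?a) = of_real (pi / real (Suc m)) * ?a"
      by (simp only: mult.assoc[symmetric] of_real_mult[symmetric])
  qed auto
  finally show ?thesis .
qed

section \<open>Point functionals\<close>

text \<open>The shape of the right-hand side of a quadrature identity. Working with closure
  properties of this class avoids computing nodes and coefficients. As functions are total,
  \<open>L\<close> is constrained only at arguments holomorphic on \<open>S\<close>.\<close>

definition point_functional :: "complex set \<Rightarrow> ((complex \<Rightarrow> complex) \<Rightarrow> complex) \<Rightarrow> bool" where
  "point_functional S L \<longleftrightarrow>
     (\<exists>Z (N :: nat) (c :: nat \<Rightarrow> complex \<Rightarrow> complex). finite Z \<and> Z \<subseteq> S \<and>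
        (\<forall>f. f holomorphic_on S \<longrightarrow> L f = (\<Sum>z\<in>Z. \<Sum>j\<le>N. c j z * (deriv ^^ j) f z)))"

lemma point_functionalI:
  assumes "finite Z" "Z \<subseteq> S"
    and "\<And>f. f holomorphic_on S \<Longrightarrow> L f = (\<Sum>z\<in>Z. \<Sum>j\<le>N. c j z * (deriv ^^ j) f z)"
  shows "point_functional S L"
  unfolding point_functional_def using assms by (intro exI[of _ Z] exI[of _ N] exI[of _ c]) simp

lemma point_functionalE:
  assumes "point_functional S L"
  obtains Z N c where "finite Z" "Z \<subseteq> S"
    "\<And>f. f holomorphic_on S \<Longrightarrow> L f = (\<Sum>z\<in>Z. \<Sum>j\<le>N. c j z * (deriv ^^ j) f z)"
proof -
  from assms obtain Z N c where "finite Z" "Z \<subseteq> S" and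
    L: "\<forall>f. f holomorphic_on S \<longrightarrow> L f = (\<Sum>z\<in>Z. \<Sum>j\<le>N. c j z * (deriv ^^ j) f z)"
    unfolding point_functional_def by (elim exE conjE)
  then show thesis by (intro that) simp_all
qed

lemma point_functional_cong:
  assumes "point_functional S L" "\<And>f. f holomorphic_on S \<Longrightarrow> L f = L' f"
  shows "point_functional S L'"
proof -
  obtain Z N c where Z: "finite Z" "Z \<subseteq> S" and
    L: "\<And>f. f holomorphic_on S \<Longrightarrow> L f = (\<Sum>z\<in>Z. \<Sum>j\<le>N. c j z * (deriv ^^ j) f z)"
    using assms(1) by (rule point_functionalE) (rule that)
  show ?thesis
    by (rule point_functionalI[OF Z, of _ c N]) (simp only: L assms(2)[symmetric])
qed

section \<open>Closure properties of point functionals\<close>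

lemma point_functional_0: "point_functional S (\<lambda>f. 0)"
  unfolding point_functional_def by (intro exI[of _ "{}"]) auto

lemma point_functional_deriv:
  assumes "z \<in> S"
  shows "point_functional S (\<lambda>f. (deriv ^^ j) f z)"
proof (rule point_functionalI[where Z = "{z}"])
  fix f assume "f holomorphic_on S"
  have "(\<Sum>i\<le>j. (if i = j then 1 else 0) * (deriv ^^ i) f z) = (\<Sum>i\<in>{j}. (deriv ^^ i) f z)"
    by (rule sum.mono_neutral_cong_right) auto
  then show "(deriv ^^ j) f z = (\<Sum>z\<in>{z}. \<Sum>i\<le>j. (if i = j then 1 else 0) * (deriv ^^ i) f z)"
    by simp
qed (use assms in auto)

lemma point_functional_eval: "z \<in> S \<Longrightarrow> point_functional S (\<lambda>f. f z)"
  using point_functional_deriv[of z S 0] by simp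

lemma point_functional_cmult:
  assumes "point_functional S L"
  shows "point_functional S (\<lambda>f. a * L f)"
proof -
  obtain Z N c where Z: "finite Z" "Z \<subseteq> S" and
    L: "\<And>f. f holomorphic_on S \<Longrightarrow> L f = (\<Sum>z\<in>Z. \<Sum>j\<le>N. c j z * (deriv ^^ j) f z)"
    using assms by (rule point_functionalE) (rule that)
  show ?thesis
    by (rule point_functionalI[OF Z, of _ "\<lambda>j z. a * c j z" N])
       (simp add: L sum_distrib_left mult.assoc)
qed

lemma point_functional_add:
  assumes "point_functional S L" "point_functional S L'"
  shows "point_functional S (\<lambda>f. L f + L' f)"
proof -
  obtain Z N c where Z: "finite Z" "Z \<subseteq> S" and
    L: "\<And>f. f holomorphic_on S \<Longrightarrow> L f = (\<Sum>z\<in>Z. \<Sum>j\<le>N. c j z * (deriv ^^ j) f z)"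
    using assms(1) by (rule point_functionalE) (rule that)
  obtain Z' N' c' where Z': "finite Z'" "Z' \<subseteq> S" and
    L': "\<And>f. f holomorphic_on S \<Longrightarrow> L' f = (\<Sum>z\<in>Z'. \<Sum>j\<le>N'. c' j z * (deriv ^^ j) f z)"
    using assms(2) by (rule point_functionalE) (rule that)
  \<comment> \<open>Coefficients are padded with 0 so that both sums can run over the union of the
    nodes and up to the larger order.\<close>
  define d where "d = (\<lambda>Z (N::nat) (c :: nat \<Rightarrow> complex \<Rightarrow> complex) j z. if z \<in> Z \<and> j \<le> N then c j z else 0)"
  have extend: "(\<Sum>z\<in>Z\<^sub>1. \<Sum>j\<le>N\<^sub>1. c j z * D j z) = (\<Sum>z\<in>Z\<^sub>2. \<Sum>j\<le>N\<^sub>2. d Z\<^sub>1 N\<^sub>1 c j z * D j z)"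
    if "Z\<^sub>1 \<subseteq> Z\<^sub>2" "N\<^sub>1 \<le> N\<^sub>2" "finite Z\<^sub>2" for Z\<^sub>1 Z\<^sub>2 N\<^sub>1 N\<^sub>2 c D
  proof (rule sum.mono_neutral_cong_left)
    show "\<forall>z\<in>Z\<^sub>2 - Z\<^sub>1. (\<Sum>j\<le>N\<^sub>2. d Z\<^sub>1 N\<^sub>1 c j z * D j z) = 0"
      by (simp add: d_def)
    show "(\<Sum>j\<le>N\<^sub>1. c j z * D j z) = (\<Sum>j\<le>N\<^sub>2. d Z\<^sub>1 N\<^sub>1 c j z * D j z)" if "z \<in> Z\<^sub>1" for z
      using \<open>N\<^sub>1 \<le> N\<^sub>2\<close> that by (intro sum.mono_neutral_cong_left) (simp_all add: d_def)
  qed (use that in auto)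
  show ?thesis unfolding point_functional_def
  proof (intro exI conjI allI impI)
    fix f assume f: "f holomorphic_on S"
    have "L f = (\<Sum>z\<in>Z \<union> Z'. \<Sum>j\<le>max N N'. d Z N c j z * (deriv ^^ j) f z)"
      using Z Z' L[OF f] by (subst extend[symmetric]) auto
    moreover have "L' f = (\<Sum>z\<in>Z \<union> Z'. \<Sum>j\<le>max N N'. d Z' N' c' j z * (deriv ^^ j) f z)"
      using Z Z' L'[OF f] by (subst extend[symmetric]) auto
    ultimately show "L f + L' f =
        (\<Sum>z\<in>Z \<union> Z'. \<Sum>j\<le>max N N'. (d Z N c j z + d Z' N' c' j z) * (deriv ^^ j) f z)"
      by (simp only: ring_distribs sum.distrib)
  qed (use Z Z' in auto)
qed

lemma point_functional_diff:
  assumes "point_functional S L" "point_functional S L'"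
  shows "point_functional S (\<lambda>f. L f - L' f)"
  using point_functional_add[OF assms(1) point_functional_cmult[OF assms(2), of "-1"]] by simp

lemma point_functional_sum:
  assumes "\<And>i. i \<in> I \<Longrightarrow> point_functional S (L i)"
  shows "point_functional S (\<lambda>f. \<Sum>i\<in>I. L i f)"
  using assms
  by (induction I rule: infinite_finite_induct)
     (auto intro: point_functional_add point_functional_0)

text \<open>Substitution principle, applied below both to divided differences and to the pullback of
  h to (h o F) * F'.\<close>

lemma point_functional_compose:
  assumes "point_functional S L"
    and "\<And>f. f holomorphic_on T \<Longrightarrow> A f holomorphic_on S"
    and "\<And>z j. z \<in> S \<Longrightarrow> point_functional T (\<lambda>f. (deriv ^^ j) (A f) z)"
  shows "point_functional T (\<lambda>f. L (A f))"
proof -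
  obtain Z N c where Z: "finite Z" "Z \<subseteq> S" and
    L: "\<And>f. f holomorphic_on S \<Longrightarrow> L f = (\<Sum>z\<in>Z. \<Sum>j\<le>N. c j z * (deriv ^^ j) f z)"
    using assms(1) by (rule point_functionalE) (rule that)
  have "point_functional T (\<lambda>f. \<Sum>z\<in>Z. \<Sum>j\<le>N. c j z * (deriv ^^ j) (A f) z)"
    using Z by (intro point_functional_sum point_functional_cmult assms(3)) auto
  then show ?thesis
    by (rule point_functional_cong) (simp add: L assms(2))
qed

text \<open>By the chain and product rules, differentiating
  \<open>(deriv ^^ m) f (g w) * k w\<close> yields two terms of the same form: one with
  \<open>Suc m\<close> and weight g' k, one with \<open>m\<close> and weight k'. Hence the induction
  on \<open>j\<close> generalizes over \<open>m\<close> and \<open>k\<close>.\<close>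

lemma point_functional_pullback:
  assumes S: "open S" and g: "g holomorphic_on S" "g ` S \<subseteq> T" and T: "open T"
    and k: "k holomorphic_on S" and z: "z \<in> S"
  shows "point_functional T (\<lambda>f. (deriv ^^ j) (\<lambda>w. (deriv ^^ m) f (g w) * k w) z)"
  using k
proof (induction j arbitrary: m k)
  case 0
  have "point_functional T (\<lambda>f. k z * (deriv ^^ m) f (g z))"
    using z g by (intro point_functional_cmult point_functional_deriv) auto
  then show ?case by (simp add: mult.commute)
next
  case (Suc j)
  have fm: "(deriv ^^ m) f holomorphic_on T" if "f holomorphic_on T" for f m
    using that T by (rule holomorphic_higher_deriv)
  have comp: "(\<lambda>w. (deriv ^^ m) f (g w)) holomorphic_on S" if "f holomorphic_on T" for f m
    using holomorphic_on_compose_gen[OF g(1) fm[OF that] g(2)] by (simp add: o_def)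
  have kd: "deriv k holomorphic_on S" "deriv g holomorphic_on S"
    using Suc.prems S g by (auto intro: holomorphic_deriv)
  have "point_functional T (\<lambda>f. (deriv ^^ j) (\<lambda>w. (deriv ^^ Suc m) f (g w) * (deriv g w * k w)) z +
           (deriv ^^ j) (\<lambda>w. (deriv ^^ m) f (g w) * deriv k w) z)"
    using Suc.prems kd by (intro point_functional_add Suc.IH holomorphic_on_mult)
  then show ?case
  proof (rule point_functional_cong)
    fix f assume f: "f holomorphic_on T"
    have der: "deriv (\<lambda>w. (deriv ^^ m) f (g w) * k w) w =
        (deriv ^^ Suc m) f (g w) * (deriv g w * k w) + (deriv ^^ m) f (g w) * deriv k w"
      if "w \<in> S" for w
    proof -
      have "g w \<in> T" using that g by auto
      have "((deriv ^^ m) f has_field_derivative (deriv ^^ Suc m) f (g w)) (at (g w))"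
        using holomorphic_derivI[OF fm[OF f] T \<open>g w \<in> T\<close>] by simp
      moreover have "(g has_field_derivative deriv g w) (at w)" "(k has_field_derivative deriv k w) (at w)"
        using that S g Suc.prems by (auto intro: holomorphic_derivI)
      ultimately show ?thesis
        by (intro DERIV_imp_deriv) (auto intro!: derivative_eq_intros DERIV_chain2[where f="(deriv ^^ m) f"] simp: algebra_simps)
    qed
    have hol: "(\<lambda>w. (deriv ^^ m) f (g w) * k w) holomorphic_on S"
        "(\<lambda>w. (deriv ^^ Suc m) f (g w) * (deriv g w * k w)) holomorphic_on S"
        "(\<lambda>w. (deriv ^^ m) f (g w) * deriv k w) holomorphic_on S"
      by (intro holomorphic_on_mult comp[OF f] Suc.prems kd)+
    have "(deriv ^^ Suc j) (\<lambda>w. (deriv ^^ m) f (g w) * k w) z =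
      (deriv ^^ j) (deriv (\<lambda>w. (deriv ^^ m) f (g w) * k w)) z"
      by (simp add: funpow_swap1)
    also have "\<dots> = (deriv ^^ j) (\<lambda>w. (deriv ^^ Suc m) f (g w) * (deriv g w * k w) + (deriv ^^ m) f (g w) * deriv k w) z"
      by (rule higher_deriv_transform_within_open[OF holomorphic_deriv[OF hol(1) S]
            holomorphic_on_add[OF hol(2,3)] S z der])
    also have "\<dots> = (deriv ^^ j) (\<lambda>w. (deriv ^^ Suc m) f (g w) * (deriv g w * k w)) z +
           (deriv ^^ j) (\<lambda>w. (deriv ^^ m) f (g w) * deriv k w) z"
      by (rule higher_deriv_add[OF hol(2,3) S z])
    finally show "(deriv ^^ j) (\<lambda>w. (deriv ^^ Suc m) f (g w) * (deriv g w * k w)) z +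
           (deriv ^^ j) (\<lambda>w. (deriv ^^ m) f (g w) * deriv k w) z =
        (deriv ^^ Suc j) (\<lambda>w. (deriv ^^ m) f (g w) * k w) z" by simp
  qed
qed

section \<open>Divided differences and contour integrals against rational functions\<close>

definition divided_difference :: "complex \<Rightarrow> (complex \<Rightarrow> complex) \<Rightarrow> complex \<Rightarrow> complex" where
  "divided_difference a f z = (if z = a then deriv f a else (f z - f a) / (z - a))"

lemma divided_difference_mult: "(z - a) * divided_difference a f z = f z - f a"
  by (simp add: divided_difference_def)

lemma holomorphic_divided_difference:
  assumes "f holomorphic_on S" "open S"
  shows "divided_difference a f holomorphic_on S"
  unfolding divided_difference_def by (rule pole_lemma_open[OF assms])

text \<open>With d the divided difference, the Leibniz rule for (z - a) d(z) = f(z) - f(a) gives (z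
  - a) d^(j+1)(z) = f^(j+1)(z) - (j+1) d^(j)(z). At z = a the left side vanishes and d^(j)(a) can be
  read off; elsewhere division by z - a gives an induction on \<open>j\<close>.\<close>

lemma point_functional_divided_difference:
  assumes S: "open S" and a: "a \<in> S" and z: "z \<in> S"
  shows "point_functional S (\<lambda>f. (deriv ^^ j) (divided_difference a f) z)"
proof -
  have rec: "(z - a) * (deriv ^^ Suc j) (divided_difference a f) z
       = (deriv ^^ Suc j) f z - of_nat (Suc j) * (deriv ^^ j) (divided_difference a f) z"
    if f: "f holomorphic_on S" for f j
  proof -
    let ?d = "divided_difference a f"
    note d = holomorphic_divided_difference[OF f S]
    have "(deriv ^^ Suc j) (\<lambda>w. (w - a) * ?d w) z =
        (\<Sum>i = 0..Suc j. of_nat (Suc j choose i) * (deriv ^^ i) (\<lambda>w. w - a) z * (deriv ^^ (Suc j - i)) ?d z)"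
      by (intro higher_deriv_mult[OF _ d S z] holomorphic_intros)
    also have "\<dots> = (\<Sum>i\<in>{0,1}. of_nat (Suc j choose i) * (deriv ^^ i) (\<lambda>w. w - a) z * (deriv ^^ (Suc j - i)) ?d z)"
    proof (intro sum.mono_neutral_right ballI)
      fix i assume "i \<in> {0..Suc j} - {0, 1}"
      then have "(deriv ^^ i) (\<lambda>w. w - a) z = 0"
        by (subst higher_deriv_diff[of _ UNIV]) auto
      then show "of_nat (Suc j choose i) * (deriv ^^ i) (\<lambda>w. w - a) z * (deriv ^^ (Suc j - i)) ?d z = 0" 
        by simp
    qed auto
    also have "\<dots> = (z - a) * (deriv ^^ Suc j) ?d z + of_nat (Suc j) * (deriv ^^ j) ?d z"
      by (simp add: algebra_simps)
    also have "(deriv ^^ Suc j) (\<lambda>w. (w - a) * ?d w) z = (deriv ^^ Suc j) (\<lambda>w. f w - f a) z"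
      by (simp only: divided_difference_mult)
    also have "\<dots> = (deriv ^^ Suc j) f z"
      by (subst higher_deriv_diff[OF f _ S z]) auto
    finally show ?thesis by (simp add: algebra_simps)
  qed
  show ?thesis
  proof (cases "z = a")
    case True
    have "point_functional S (\<lambda>f. 1 / of_nat (Suc j) * (deriv ^^ Suc j) f z)"
      by (intro point_functional_cmult point_functional_deriv z)
    then show ?thesis
    proof (rule point_functional_cong)
      fix f assume "f holomorphic_on S"
      from rec[OF this, of j] True show "1 / of_nat (Suc j) * (deriv ^^ Suc j) f z = (deriv ^^ j) (divided_difference a f) z"
        by (simp add: field_simps del: of_nat_Suc)
    qed
  next
    case False
    show ?thesis
    proof (induction j)
      case 0
      have "point_functional S (\<lambda>f. 1 / (z - a) * (f z - f a))"
        by (intro point_functional_cmult point_functional_diff point_functional_eval z a)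
      then show ?case using False by (simp add: divided_difference_def)
    next
      case (Suc j)
      have "point_functional S (\<lambda>f. 1 / (z - a) * ((deriv ^^ Suc j) f z - of_nat (Suc j) * (deriv ^^ j) (divided_difference a f) z))"
        by (intro point_functional_cmult point_functional_diff point_functional_deriv Suc.IH z a)
      then show ?case
      proof (rule point_functional_cong)
        fix f assume "f holomorphic_on S"
        from rec[OF this, of j] False 
        show "1 / (z - a) * ((deriv ^^ Suc j) f z - of_nat (Suc j) * (deriv ^^ j) (divided_difference a f) z) = (deriv ^^ Suc j) (divided_difference a f) z"
          by (simp add: field_simps del: of_nat_Suc funpow.simps)
      qed
    qed
  qed
qed

text \<open>
  Induction on the degree of \<open>B\<close>: at a root \<open>a\<close> of \<open>B\<close>, write \<open>f z = f a + (z - a) * d z\<close> with the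
  divided difference \<open>d\<close>, which cancels one factor of \<open>B\<close>.
\<close>

lemma point_functional_rational_contour:
  fixes A B :: "complex poly"
  assumes "B \<noteq> 0" "\<And>z. poly B z = 0 \<Longrightarrow> cmod z < r" and r: "0 < r" "r < \<rho>"
  shows "point_functional (ball 0 \<rho>)
           (\<lambda>f. contour_integral (circlepath 0 r) (\<lambda>z. f z * (poly A z / poly B z)))"
  using assms(1,2)
proof (induction "degree B" arbitrary: B)
  case 0
  then obtain b where B: "B = [:b:]" by (metis degree_eq_zeroE)
  show ?case
  proof (rule point_functional_cong[OF point_functional_0])
    fix f assume f: "f holomorphic_on ball 0 \<rho>"
    \<comment> \<open>A constant denominator leaves a holomorphic integrand, so Cauchy's theorem
      gives 0.\<close>
    have "((\<lambda>z. f z * (poly A z / b)) has_contour_integral 0) (circlepath 0 r)"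
    proof (rule Cauchy_theorem_disc_simple)
      show "(\<lambda>z. f z * (poly A z / b)) holomorphic_on ball 0 \<rho>"
        using 0 B f by (intro holomorphic_intros) auto
    qed (use r in auto)
    then show "0 = contour_integral (circlepath 0 r) (\<lambda>z. f z * (poly A z / poly B z))"
      by (simp add: B contour_integral_unique)
  qed
next
  case (Suc n)
  obtain a where a: "poly B a = 0"
    using Suc.hyps(2) alg_closed_imp_poly_has_root[of B] by auto
  then obtain C where B: "B = [:-a, 1:] * C" by (metis dvdE poly_eq_0_iff_dvd)
  have C: "C \<noteq> 0" "\<And>z. poly C z = 0 \<Longrightarrow> cmod z < r"
    using Suc.prems B by auto
  have "degree B = degree [:-a, 1:] + degree C"
    using C unfolding B by (intro degree_mult_eq) auto
  then have "degree C = n" using Suc.hyps(2) by simp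
  have ar: "cmod a < r" using a Suc.prems by auto
  let ?I = "contour_integral (circlepath 0 r)"
  have "point_functional (ball 0 \<rho>) (\<lambda>f. ?I (\<lambda>z. f z * (poly A z / poly C z)))"
    using C \<open>degree C = n\<close> Suc.hyps(1) by blast
  then have "point_functional (ball 0 \<rho>) (\<lambda>f. ?I (\<lambda>z. divided_difference a f z * (poly A z / poly C z)))"
  proof (rule point_functional_compose)
    show "point_functional (ball 0 \<rho>) (\<lambda>f. (deriv ^^ j) (divided_difference a f) z)"
      if "z \<in> ball 0 \<rho>" for z j
      using ar r that by (intro point_functional_divided_difference) auto
  qed (rule holomorphic_divided_difference, auto)
  \<comment> \<open>The constant part f(a) contributes a fixed number times evaluation at
    \<open>a\<close>, which is a node inside the circle.\<close>
  moreover have "point_functional (ball 0 \<rho>) (\<lambda>f. ?I (\<lambda>z. poly A z / poly B z) * f a)"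
    using ar r by (intro point_functional_cmult point_functional_eval) auto
  ultimately have "point_functional (ball 0 \<rho>) (\<lambda>f.
       ?I (\<lambda>z. divided_difference a f z * (poly A z / poly C z)) + ?I (\<lambda>z. poly A z / poly B z) * f a)"
    by (rule point_functional_add)
  then show ?case
  proof (rule point_functional_cong)
    fix f assume f: "f holomorphic_on ball 0 \<rho>"
    have nz: "poly B z \<noteq> 0" "poly C z \<noteq> 0" "z \<noteq> a" if "cmod z = r" for z
      using that Suc.prems C ar by force+
    have d: "continuous_on (sphere 0 r) (divided_difference a f)"
      by (rule continuous_on_subset[OF holomorphic_on_imp_continuous_on[OF holomorphic_divided_difference[OF f]]])
         (use r in auto)
    have int: "(\<lambda>z. divided_difference a f z * (poly A z / poly C z)) contour_integrable_on circlepath 0 r"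
        "(\<lambda>z. f a * (poly A z / poly B z)) contour_integrable_on circlepath 0 r"
      using d nz r by (auto intro!: contour_integrable_continuous_circlepath continuous_intros)
    have "?I (\<lambda>z. f z * (poly A z / poly B z)) =
       ?I (\<lambda>z. divided_difference a f z * (poly A z / poly C z) + f a * (poly A z / poly B z))"
    proof (rule contour_integral_cong)
      fix z assume "z \<in> path_image (circlepath 0 r)"
      then have "cmod z = r" using r by simp
      with nz[of z] show "f z * (poly A z / poly B z) = divided_difference a f z * (poly A z / poly C z) + f a * (poly A z / poly B z)"
        by (simp add: divided_difference_def B divide_simps) (simp add: algebra_simps)
    qed simp
    also have "\<dots> = ?I (\<lambda>z. divided_difference a f z * (poly A z / poly C z)) + ?I (\<lambda>z. f a * (poly A z / poly B z))"
      using int by (rule contour_integral_add)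
    also have "?I (\<lambda>z. f a * (poly A z / poly B z)) = ?I (\<lambda>z. poly A z / poly B z) * f a"
      using nz r by (subst contour_integral_lmul) (auto intro!: contour_integrable_continuous_circlepath continuous_intros)
    finally show "?I (\<lambda>z. divided_difference a f z * (poly A z / poly C z)) + ?I (\<lambda>z. poly A z / poly B z) * f a
      = ?I (\<lambda>z. f z * (poly A z / poly B z))" by simp
  qed
qed

section \<open>Rational images of the disc\<close>

text \<open>With a and b the Taylor coefficients of \<open>H\<close> and \<open>f\<close>, both
  sides equal pi times the sum of a_m * cnj b_(m+1). For the area integral this is orthogonality of
  powers; for the contour integral, expand cnj (f (1 / cnj z)) in powers of 1/z and apply Cauchy's
  formula. The circle needs \<open>s < 1\<close> to lie where \<open>H\<close> is holomorphic and
  \<open>1 / \<rho> < s\<close> so that 1 / cnj z stays in the disc of \<open>f\<close>.\<close>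

lemma disc_integral_cnj_deriv:
  assumes f: "f holomorphic_on ball 0 \<rho>" and \<rho>: "1 < \<rho>"
    and H: "H holomorphic_on ball 0 1" and int: "set_integrable lborel (ball 0 1) H"
    and s: "1 / \<rho> < s" "s < 1"
  shows "(CLBINT z:ball 0 1. H z * cnj (deriv f z)) =
      1 / (2 * \<i>) * contour_integral (circlepath 0 s) (\<lambda>z. H z * cnj (f (1 / cnj z)))"
proof -
  define a where "a = (\<lambda>m. (deriv ^^ m) H 0 / fact m)"
  define b where "b = (\<lambda>m. (deriv ^^ m) f 0 / fact m)"
  define c where "c = (\<lambda>m. of_nat (Suc m) * b (Suc m))"
  have s0: "0 < s" using s \<rho> by (meson less_trans zero_less_divide_1_iff zero_less_one)
  have bs: "(\<lambda>m. b m * z ^ m) sums f z" if "cmod z < \<rho>" for z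
    using holomorphic_power_series[OF f, of z] that by (simp add: b_def)
  have cs: "(\<lambda>m. c m * z ^ m) sums deriv f z" if "cmod z < \<rho>" for z
  proof -
    have "deriv f holomorphic_on ball 0 \<rho>" using f by (intro holomorphic_deriv) auto
    from holomorphic_power_series[OF this, of z] that
    have "(\<lambda>m. (\<lambda>m. (deriv ^^ Suc m) f 0 / fact m) m * z ^ m) sums deriv f z"
      by (simp add: funpow_Suc_right del: funpow.simps)
    also have "(\<lambda>m. (deriv ^^ Suc m) f 0 / fact m) = c"
    proof
      fix m
      show "(deriv ^^ Suc m) f 0 / fact m = c m"
        unfolding c_def b_def fact_Suc of_nat_mult
        by (simp add: divide_simps del: funpow.simps of_nat_Suc)
    qed
    finally show ?thesis .
  qed
  \<comment> \<open>Convergence at a slightly larger radius gives absolute convergence at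
    \<open>t\<close>. It is used at t = 1 for \<open>c\<close> and at t = 1/s for
    \<open>b\<close>.\<close>
  have summable_norm: "summable (\<lambda>m. cmod (d m) * t ^ m)"
    if d: "\<And>z. cmod z < \<rho> \<Longrightarrow> summable (\<lambda>m. d m * z ^ m)" and t: "0 < t" "t < \<rho>" for d and t :: real
  proof -
    obtain \<sigma> where \<sigma>: "t < \<sigma>" "\<sigma> < \<rho>" using dense t(2) by blast
    have "summable (\<lambda>m. norm (d m * of_real t ^ m))"
      by (rule powser_insidea[where x = "of_real \<sigma>"]) (use d[of "of_real \<sigma>"] \<sigma> t in auto)
    then show ?thesis using t by (simp add: norm_mult norm_power)
  qed
  have csum: "summable (\<lambda>m. cmod (c m))"
    using summable_norm[of c 1] cs \<rho> by (auto simp: sums_iff)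
  have "1 / s < \<rho>" using s s0 \<rho> by (simp add: field_simps)
  then have bsum: "summable (\<lambda>m. cmod (b m) * (1 / s) ^ m)"
    using summable_norm[of b "1 / s"] bs s0 by (auto simp: sums_iff)

  have int_power: "set_integrable lborel (ball 0 1) (\<lambda>z. H z * cnj (c m * z ^ m))" for m
    using int by (rule set_integrable_mult_bounded[where K = "cmod (c m)"])
      (auto simp: norm_mult norm_power intro!: continuous_intros mult_right_le_one_le power_le_one)
  \<comment> \<open>Termwise integration of the series of the conjugate of f': the terms are
    dominated by |c_m| |H|, and the |c_m| are summable because \<rho> > 1.\<close>
  have "(\<lambda>m. CLBINT z:ball 0 1. H z * cnj (c m * z ^ m)) sums
      (\<integral>z. (\<Sum>m. indicator (ball 0 1) z *\<^sub>R (H z * cnj (c m * z ^ m))) \<partial>lborel)"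
    unfolding set_lebesgue_integral_def
  proof (rule sums_integral)
    show "integrable lborel (\<lambda>z. indicator (ball 0 1) z *\<^sub>R (H z * cnj (c m * z ^ m)))" for m
      using int_power[of m] by (simp add: set_integrable_def)
    have bd: "norm (indicator (ball 0 1) z *\<^sub>R (H z * cnj (c m * z ^ m))) \<le>
        cmod (c m) * norm (indicator (ball 0 1) z *\<^sub>R H z)" for m z
    proof -
      have "cmod (H z) * (cmod (c m) * cmod z ^ m) \<le> cmod (H z) * (cmod (c m) * 1)" if "cmod z < 1"
        using that by (intro mult_left_mono power_le_one) auto
      then show ?thesis by (auto simp: indicator_def norm_mult norm_power mult_ac)
    qed
    show "AE z in lborel. summable (\<lambda>m. norm (indicator (ball 0 1) z *\<^sub>R (H z * cnj (c m * z ^ m))))"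
      by (intro AE_I2 summable_comparison_test'[OF summable_mult2[OF csum]])
         (use bd in simp)
    have Hn: "integrable lborel (\<lambda>z. norm (indicator (ball 0 1) z *\<^sub>R H z))"
      using int unfolding set_integrable_def by (rule integrable_norm)
    have "(\<integral>z. norm (indicator (ball 0 1) z *\<^sub>R (H z * cnj (c m * z ^ m))) \<partial>lborel) \<le>
      cmod (c m) * (\<integral>z. norm (indicator (ball 0 1) z *\<^sub>R H z) \<partial>lborel)" for m
      unfolding integral_mult_right_zero[symmetric]
      using int_power[of m] Hn bd
      by (intro integral_mono integrable_norm) (auto simp: set_integrable_def)
    then show "summable (\<lambda>m. \<integral>z. norm (indicator (ball 0 1) z *\<^sub>R (H z * cnj (c m * z ^ m))) \<partial>lborel)"
      by (intro summable_comparison_test'[OF summable_mult2[OF csum]]) simp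
  qed
  also have "(\<integral>z. (\<Sum>m. indicator (ball 0 1) z *\<^sub>R (H z * cnj (c m * z ^ m))) \<partial>lborel) =
      (CLBINT z:ball 0 1. H z * cnj (deriv f z))"
    unfolding set_lebesgue_integral_def
  proof (intro Bochner_Integration.integral_cong refl)
    fix z
    have "(\<lambda>m. H z * cnj (c m * z ^ m)) sums (H z * cnj (deriv f z))" if "cmod z < 1"
      using that \<rho> by (intro sums_mult sums_cnj[THEN iffD2] cs) auto
    then show "(\<Sum>m. indicator (ball 0 1) z *\<^sub>R (H z * cnj (c m * z ^ m))) =
       indicator (ball 0 1) z *\<^sub>R (H z * cnj (deriv f z))"
      by (cases "cmod z < 1") (auto simp: sums_iff)
  qed
  also have "(\<lambda>m. CLBINT z:ball 0 1. H z * cnj (c m * z ^ m)) = (\<lambda>m. pi * (cnj (b (Suc m)) * a m))"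
  proof
    fix m
    have "(CLBINT z:ball 0 1. H z * cnj (c m * z ^ m)) = (CLBINT z:ball 0 1. cnj (c m) * (H z * cnj z ^ m))"
      by (simp add: mult_ac)
    also have "\<dots> = cnj (c m) * (of_real (pi / real (Suc m)) * a m)"
      unfolding a_def set_integral_mult_right disc_integral_cnj_power[OF H int] ..
    \<comment> \<open>The factor m + 1 in c_m = (m + 1) b_(m+1) cancels the denominator of the disc
      integral.\<close>
    also have "\<dots> = pi * (cnj (b (Suc m)) * a m)"
      by (simp add: c_def del: of_nat_Suc)
    finally show "(CLBINT z:ball 0 1. H z * cnj (c m * z ^ m)) = pi * (cnj (b (Suc m)) * a m)" .
  qed
  finally have 1: "(\<lambda>m. pi * (cnj (b (Suc m)) * a m)) sums (CLBINT z:ball 0 1. H z * cnj (deriv f z))" .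

  have Hc: "continuous_on (sphere 0 s) H"
    by (rule continuous_on_subset[OF holomorphic_on_imp_continuous_on[OF H]]) (use s in auto)
  then have "compact (H ` sphere 0 s)" by (intro compact_continuous_image) auto
  then obtain K where K: "\<And>z. cmod z = s \<Longrightarrow> cmod (H z) \<le> K"
    using compact_imp_bounded bounded_iff by (metis imageI mem_sphere_0)
  \<comment> \<open>Uniform convergence on the circle, from the majorants K |b_m| / s^m, lets the
    contour integral be taken term by term.\<close>
  have unif: "uniform_limit (sphere 0 s) (\<lambda>n z. \<Sum>m<n. H z * (cnj (b m) / z ^ m))
      (\<lambda>z. \<Sum>m. H z * (cnj (b m) / z ^ m)) sequentially"
  proof (rule Weierstrass_m_test)
    show "summable (\<lambda>m. K * (cmod (b m) * (1 / s) ^ m))" using bsum by (rule summable_mult)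
    show "norm (H z * (cnj (b m) / z ^ m)) \<le> K * (cmod (b m) * (1 / s) ^ m)" if "z \<in> sphere 0 s" for m z
      using that K[of z] s0
      by (auto simp: norm_mult norm_divide norm_power norm_inverse power_inverse divide_inverse intro!: mult_right_mono)
  qed
  have lim: "(\<Sum>m. H z * (cnj (b m) / z ^ m)) = H z * cnj (f (1 / cnj z))" if "z \<in> sphere 0 s" for z
  proof -
    have "cmod (1 / cnj z) < \<rho>" using that \<open>1 / s < \<rho>\<close> by (simp add: norm_divide)
    then have "(\<lambda>m. H z * cnj (b m * (1 / cnj z) ^ m)) sums (H z * cnj (f (1 / cnj z)))"
      by (intro sums_mult sums_cnj[THEN iffD2] bs)
    then show ?thesis by (simp add: sums_iff divide_inverse power_inverse)
  qed
  \<comment> \<open>The term with b_0 is holomorphic and integrates to 0; the term with b_(k+1)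
    extracts a_k. This shift by one matches the one caused by the derivative in the area
    integral.\<close>
  have coeff: "((\<lambda>z. H z * (cnj (b m) / z ^ m)) has_contour_integral
      (case m of 0 \<Rightarrow> 0 | Suc k \<Rightarrow> cnj (b m) * (2 * pi * \<i> * a k))) (circlepath 0 s)" for m
  proof (cases m)
    case 0
    have "((\<lambda>z. H z * cnj (b 0)) has_contour_integral 0) (circlepath 0 s)"
      by (rule Cauchy_theorem_disc_simple[of _ 0 1])
         (use H s s0 in \<open>auto intro!: holomorphic_intros\<close>)
    then show ?thesis by (simp add: 0)
  next
    case (Suc k)
    have "((\<lambda>z. H z / (z - 0) ^ Suc k) has_contour_integral (2 * pi * \<i> / fact k * (deriv ^^ k) H 0)) (circlepath 0 s)"
      using s s0 holomorphic_on_imp_continuous_on[OF H]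
      by (intro Cauchy_has_contour_integral_higher_derivative_circlepath holomorphic_on_subset[OF H])
         (auto elim!: continuous_on_subset)
    from has_contour_integral_lmul[OF this, of "cnj (b m)"] show ?thesis
      by (simp add: Suc a_def mult_ac)
  qed
  have "(\<lambda>n. contour_integral (circlepath 0 s) (\<lambda>z. \<Sum>m<n. H z * (cnj (b m) / z ^ m))) \<longlonglongrightarrow>
      contour_integral (circlepath 0 s) (\<lambda>z. \<Sum>m. H z * (cnj (b m) / z ^ m))"
  proof (rule contour_integral_uniform_limit_circlepath)
    show "\<forall>\<^sub>F n in sequentially. (\<lambda>z. \<Sum>m<n. H z * (cnj (b m) / z ^ m)) contour_integrable_on circlepath 0 s"
      by (intro always_eventually allI contour_integrable_sum has_contour_integral_integrable[OF coeff]) auto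
  qed (use unif s0 in auto)
  moreover have "contour_integral (circlepath 0 s) (\<lambda>z. \<Sum>m. H z * (cnj (b m) / z ^ m)) =
      contour_integral (circlepath 0 s) (\<lambda>z. H z * cnj (f (1 / cnj z)))"
    using s0 by (intro contour_integral_cong lim) auto
  moreover have "contour_integral (circlepath 0 s) (\<lambda>z. \<Sum>m<n. H z * (cnj (b m) / z ^ m)) =
      (\<Sum>m<n. case m of 0 \<Rightarrow> 0 | Suc k \<Rightarrow> cnj (b m) * (2 * pi * \<i> * a k))" for n
    by (intro contour_integral_unique has_contour_integral_sum coeff) auto
  ultimately have "(\<lambda>m. case m of 0 \<Rightarrow> 0 | Suc k \<Rightarrow> cnj (b m) * (2 * pi * \<i> * a k)) sums
      contour_integral (circlepath 0 s) (\<lambda>z. H z * cnj (f (1 / cnj z)))"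
    by (simp add: sums_def)
  then have "(\<lambda>m. cnj (b (Suc m)) * (2 * pi * \<i> * a m)) sums
      contour_integral (circlepath 0 s) (\<lambda>z. H z * cnj (f (1 / cnj z)))"
    using sums_Suc_iff[of "\<lambda>m. case m of 0 \<Rightarrow> 0 | Suc k \<Rightarrow> cnj (b m) * (2 * pi * \<i> * a k)"] by simp
  then have "(\<lambda>m. 1 / (2 * \<i>) * (cnj (b (Suc m)) * (2 * pi * \<i> * a m))) sums
      (1 / (2 * \<i>) * contour_integral (circlepath 0 s) (\<lambda>z. H z * cnj (f (1 / cnj z))))"
    by (rule sums_mult)
  moreover have "1 / (2 * \<i>) * (cnj (b (Suc m)) * (2 * pi * \<i> * a m)) = pi * (cnj (b (Suc m)) * a m)" for m
  proof -
    have "1 / (2 * \<i>) * (cnj (b (Suc m)) * (2 * pi * \<i> * a m)) =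
        (1 / (2 * \<i>) * (2 * \<i>)) * (pi * (cnj (b (Suc m)) * a m))"
      by (simp only: mult_ac of_real_mult of_real_numeral)
    then show ?thesis by simp
  qed
  ultimately have "(\<lambda>m. pi * (cnj (b (Suc m)) * a m)) sums
      (1 / (2 * \<i>) * contour_integral (circlepath 0 s) (\<lambda>z. H z * cnj (f (1 / cnj z))))"
    by (simp only:)
  with 1 show ?thesis by (rule sums_unique2)
qed

lemma quadrature_domain_rational_image:
  fixes p q :: "complex poly"
  assumes q: "\<And>z. z \<in> cball 0 1 \<Longrightarrow> poly q z \<noteq> 0"
    and inj: "inj_on (\<lambda>z. poly p z / poly q z) unit_disc"
  shows "quadrature_domain ((\<lambda>z. poly p z / poly q z) ` unit_disc)"
proof -
  define F where "F = (\<lambda>z. poly p z / poly q z)"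
  define \<Omega> where "\<Omega> = F ` unit_disc"
  have q0: "q \<noteq> 0" using q[of 0] by auto
  obtain \<rho> where \<rho>: "1 < \<rho>" and qr: "\<And>z. cmod z < \<rho> \<Longrightarrow> poly q z \<noteq> 0"
  proof
    \<comment> \<open>The least modulus of a root of \<open>q\<close>; the inserted 2 keeps the set
      nonempty when there are no roots.\<close>
    define \<rho> where "\<rho> = Min (insert 2 (cmod ` {z. poly q z = 0}))"
    have fin: "finite (insert 2 (cmod ` {z. poly q z = 0}))"
      using poly_roots_finite[OF q0] by auto
    show "1 < \<rho>"
      unfolding \<rho>_def using fin q by (subst Min_gr_iff) (auto simp: not_le[symmetric])
    show "poly q z \<noteq> 0" if "cmod z < \<rho>" for z
    proof
      assume "poly q z = 0"
      then have "\<rho> \<le> cmod z" unfolding \<rho>_def using fin by (intro Min_le) auto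
      with that show False by simp
    qed
  qed
  have holF: "F holomorphic_on ball 0 \<rho>"
    unfolding F_def using qr by (intro holomorphic_intros) auto
  have holF1: "F holomorphic_on unit_disc"
    by (rule holomorphic_on_subset[OF holF]) (use \<rho> in auto)
  have injF: "inj_on F unit_disc" using inj by (simp add: F_def)
  have op: "open \<Omega>"
    unfolding \<Omega>_def by (rule open_mapping_thm3[OF holF1 open_ball injF])
  have "connected \<Omega>"
    unfolding \<Omega>_def by (intro connected_continuous_image holomorphic_on_imp_continuous_on holF1) simp
  have "\<Omega> \<noteq> {}" by (simp add: \<Omega>_def)
  have dF: "deriv F holomorphic_on ball 0 \<rho>" using holF by (intro holomorphic_deriv) auto
  have dF1: "deriv F holomorphic_on unit_disc"
    by (rule holomorphic_on_subset[OF dF]) (use \<rho> in auto)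
  obtain K where K: "\<And>z. z \<in> unit_disc \<Longrightarrow> cmod (deriv F z) \<le> K"
  proof -
    have "continuous_on (cball 0 1) (deriv F)"
      by (rule continuous_on_subset[OF holomorphic_on_imp_continuous_on[OF dF]]) (use \<rho> in auto)
    then have "bounded (deriv F ` cball 0 1)"
      by (intro compact_imp_bounded compact_continuous_image) auto
    then show thesis using that unfolding bounded_iff by force
  qed
  obtain s where s: "1 / \<rho> < s" "s < 1" using dense[of "1 / \<rho>" 1] \<rho> by auto
  have s0: "0 < s" using s \<rho> by (meson less_trans zero_less_divide_1_iff zero_less_one)
  \<comment> \<open>Conjugation moves to the coefficients, and the reflected polynomials express the
    values at 1/z up to a power of z. The monomials in \<open>A\<close> and \<open>B\<close> balance
    these two powers.\<close>
  define A where "A = reflect_poly (map_poly cnj p) * monom 1 (degree (map_poly cnj q))"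
  define B where "B = reflect_poly (map_poly cnj q) * monom 1 (degree (map_poly cnj p))"
  define L where "L = (\<lambda>H. 1 / (2 * \<i>) * contour_integral (circlepath 0 s) (\<lambda>z. H z * (poly A z / poly B z)))"
  have AB: "cnj (F (1 / cnj z)) = poly A z / poly B z" if "z \<noteq> 0" for z
    using that by (simp add: F_def A_def B_def poly_reflect_poly_nz poly_monom inverse_eq_divide)
  have "point_functional unit_disc L"
    unfolding L_def
  proof (intro point_functional_cmult point_functional_rational_contour)
    have "map_poly cnj q \<noteq> 0" using q0 by (subst map_poly_eq_0_iff) auto
    then show "B \<noteq> 0" by (simp add: B_def)
    \<comment> \<open>A zero of \<open>B\<close> is either 0 or the mirror image 1 / cnj w of a root
      w of \<open>q\<close>; since |w| is at least \<rho>, its modulus is at most 1/\<rho>, below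
      \<open>s\<close>.\<close>
    show "cmod z < s" if "poly B z = 0" for z
    proof (cases "z = 0")
      case False
      with that have "poly q (1 / cnj z) = 0"
        by (simp add: B_def poly_reflect_poly_nz poly_monom inverse_eq_divide)
      with qr have "\<rho> \<le> cmod (1 / cnj z)" by (meson not_le)
      then have "cmod z \<le> 1 / \<rho>" using False \<rho> by (simp add: norm_divide field_simps)
      with s show ?thesis by simp
    qed (use s0 in simp)
  qed (use s s0 in auto)
  then have pf: "point_functional \<Omega> (\<lambda>h. L (\<lambda>z. h (F z) * deriv F z))"
  proof (rule point_functional_compose)
    show "(\<lambda>z. h (F z) * deriv F z) holomorphic_on unit_disc" if "h holomorphic_on \<Omega>" for h
      using holomorphic_on_compose[OF holF1, of h] that dF1
      by (auto intro!: holomorphic_on_mult simp: \<Omega>_def o_def)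
    show "point_functional \<Omega> (\<lambda>h. (deriv ^^ j) (\<lambda>z. h (F z) * deriv F z) z)" if "z \<in> unit_disc" for z j
      using point_functional_pullback[OF open_ball holF1 _ op dF1 that, of j 0] by (simp add: \<Omega>_def)
  qed
  have main: "set_integrable lborel \<Omega> h \<and> set_lebesgue_integral lborel \<Omega> h = L (\<lambda>z. h (F z) * deriv F z)"
    if h: "h \<in> bergman_space \<Omega>" for h
  proof -
    define H where "H = (\<lambda>z. h (F z) * deriv F z)"
    have holh: "h holomorphic_on \<Omega>" and sq: "set_integrable lborel \<Omega> (\<lambda>z. (cmod (h z))\<^sup>2)"
      using h by (auto simp: bergman_space_def)
    have hc: "continuous_on (F ` unit_disc) h"
      using holh holomorphic_on_imp_continuous_on by (simp add: \<Omega>_def)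
    have holH: "H holomorphic_on unit_disc"
      using holomorphic_on_compose[OF holF1, of h] holh dF1
      by (auto intro!: holomorphic_on_mult simp: \<Omega>_def o_def H_def)
    have Hc: "continuous_on unit_disc H" using holH by (rule holomorphic_on_imp_continuous_on)
    \<comment> \<open>The conformal change of variables is stated for complex-valued functions, so
      the square of the modulus is regarded as one. The result is that \<open>H\<close> is
      square-integrable on the disc.\<close>
    have "set_integrable lborel \<Omega> (\<lambda>z. complex_of_real ((cmod (h z))\<^sup>2))"
    proof -
      have "integrable lborel (\<lambda>z. complex_of_real (indicator \<Omega> z *\<^sub>R (cmod (h z))\<^sup>2))"
        using sq unfolding set_integrable_def by (rule integrable_of_real)
      then show ?thesis by (simp add: set_integrable_def scaleR_conv_of_real)
    qed
    then have "set_integrable lborel unit_disc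
        (\<lambda>z. of_real ((cmod (deriv F z))\<^sup>2) * complex_of_real ((cmod (h (F z)))\<^sup>2))"
      unfolding \<Omega>_def
      by (subst (asm) set_integrable_conformal[OF open_ball holF1 injF]) (auto intro!: continuous_intros hc)
    also have "(\<lambda>z. of_real ((cmod (deriv F z))\<^sup>2) * complex_of_real ((cmod (h (F z)))\<^sup>2)) =
       (\<lambda>z. complex_of_real ((cmod (H z))\<^sup>2))"
      by (simp add: H_def norm_mult power_mult_distrib mult_ac)
    finally have H2: "set_integrable lborel unit_disc (\<lambda>z. complex_of_real ((cmod (H z))\<^sup>2))" .
    have one: "set_integrable lborel unit_disc (\<lambda>z. 1 :: complex)"
      unfolding set_integrable_def
      by (intro integrable_scaleR_left integrable_real_indicator emeasure_bounded_finite) auto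
    \<comment> \<open>Square-integrable implies integrable on a set of finite area, by x \<le> 1 +
      x^2.\<close>
    have intH: "set_integrable lborel unit_disc H"
      unfolding set_integrable_def
    proof (rule Bochner_Integration.integrable_bound)
      show "integrable lborel (\<lambda>z. indicator unit_disc z *\<^sub>R (1 + complex_of_real ((cmod (H z))\<^sup>2)))"
        using set_integral_add(1)[OF one H2] by (simp add: set_integrable_def)
      show "(\<lambda>z. indicator unit_disc z *\<^sub>R H z) \<in> borel_measurable lborel"
        using borel_measurable_continuous_on_indicator[OF _ Hc] by simp
      have "x \<le> cmod (1 + (complex_of_real x)\<^sup>2)" for x
      proof -
        have "x \<le> 1 + x\<^sup>2" using zero_le_power2[of "x - 1 / 2"] by (simp add: power2_eq_square algebra_simps)
        also have "\<dots> = Re (1 + (complex_of_real x)\<^sup>2)" by (simp flip: of_real_power)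
        also have "\<dots> \<le> cmod (1 + (complex_of_real x)\<^sup>2)" by (rule complex_Re_le_cmod)
        finally show ?thesis .
      qed
      then show "AE z in lborel. norm (indicator unit_disc z *\<^sub>R H z) \<le>
          norm (indicator unit_disc z *\<^sub>R (1 + complex_of_real ((cmod (H z))\<^sup>2)))"
        by (intro AE_I2) (simp add: indicator_def)
    qed
    \<comment> \<open>Of |F'|^2 = F' * cnj F', the holomorphic factor is absorbed into
      \<open>H\<close>.\<close>
    have eq: "of_real ((cmod (deriv F z))\<^sup>2) * h (F z) = H z * cnj (deriv F z)" for z
      by (simp add: H_def complex_norm_square mult_ac del: of_real_power)
    have "set_integrable lborel unit_disc (\<lambda>z. H z * cnj (deriv F z))"
      using intH by (rule set_integrable_mult_bounded[where K = K])
        (auto intro!: continuous_intros holomorphic_on_imp_continuous_on[OF dF1] K)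
    then have inth: "set_integrable lborel \<Omega> h"
      unfolding \<Omega>_def by (subst set_integrable_conformal[OF open_ball holF1 injF hc]) (simp only: eq)
    have "set_lebesgue_integral lborel \<Omega> h = (CLBINT z:unit_disc. H z * cnj (deriv F z))"
      using inth unfolding \<Omega>_def
      by (subst set_lebesgue_integral_conformal[OF open_ball holF1 injF hc]) (simp_all only: eq)
    also have "\<dots> = 1 / (2 * \<i>) * contour_integral (circlepath 0 s) (\<lambda>z. H z * cnj (F (1 / cnj z)))"
      by (rule disc_integral_cnj_deriv[OF holF \<rho> holH intH s])
    also have "contour_integral (circlepath 0 s) (\<lambda>z. H z * cnj (F (1 / cnj z))) =
        contour_integral (circlepath 0 s) (\<lambda>z. H z * (poly A z / poly B z))"
      using s0 by (intro contour_integral_cong refl arg_cong2[where f = "(*)"] AB) auto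
    finally show ?thesis using inth by (simp add: L_def H_def)
  qed
  obtain Z N c where "finite Z" "Z \<subseteq> \<Omega>" and
    Z: "\<And>h. h holomorphic_on \<Omega> \<Longrightarrow>
       L (\<lambda>z. h (F z) * deriv F z) = (\<Sum>z\<in>Z. \<Sum>j\<le>N. c j z * (deriv ^^ j) h z)"
    using pf by (rule point_functionalE) (rule that)
  have "quadrature_domain \<Omega>"
    unfolding quadrature_domain_def
  proof (intro conjI exI[of _ Z] exI[of _ N] exI[of _ c] ballI)
    fix h assume h: "h \<in> bergman_space \<Omega>"
    then have "h holomorphic_on \<Omega>" by (simp add: bergman_space_def)
    from Z[OF this] main[OF h] show "set_integrable lborel \<Omega> h"
      "set_lebesgue_integral lborel \<Omega> h = (\<Sum>z\<in>Z. \<Sum>j\<le>N. c j z * (deriv ^^ j) h z)" by auto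
  qed fact+
  then show ?thesis by (simp add: \<Omega>_def F_def)
qed

section \<open>The rescaled straight-line homotopy\<close>

text \<open>\<open>rational_on\<close> excludes poles only in the open disc. The continuous
  extension excludes them on the circle too, which leaves room for a larger pole-free disc.\<close>

lemma rational_on_closed_disc:
  assumes R: "rational_on R unit_disc" and ext: "continuous_on (cball 0 1) g"
    and eq: "\<And>z. z \<in> unit_disc \<Longrightarrow> g z = R z"
  obtains p q :: "complex poly" where "\<And>z. z \<in> cball 0 1 \<Longrightarrow> poly q z \<noteq> 0"
    "\<And>z. z \<in> unit_disc \<Longrightarrow> R z = poly p z / poly q z"
proof -
  \<comment> \<open>In a representation with \<open>q\<close> of least degree, a zero of \<open>q\<close> on the circle would also be a zero of \<open>p\<close>.\<close>
  define P where "P = (\<lambda>n. \<exists>p q :: complex poly. degree q = n \<and> (\<forall>z\<in>unit_disc. poly q z \<noteq> 0 \<and> R z = poly p z / poly q z))"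
  have "\<exists>n. P n" using R unfolding rational_on_def P_def by blast
  then have "P (LEAST n. P n)" by (rule LeastI_ex)
  then obtain p q :: "complex poly" where least: "degree q = (LEAST n. P n)"
    and pq: "\<And>z. z \<in> unit_disc \<Longrightarrow> poly q z \<noteq> 0" "\<And>z. z \<in> unit_disc \<Longrightarrow> R z = poly p z / poly q z"
    unfolding P_def by blast
  have "poly q a \<noteq> 0" if a: "a \<in> cball 0 1" for a
  proof
    assume qa: "poly q a = 0"
    \<comment> \<open>The identity p = g q passes by continuity from the open disc to its closure,
      hence holds at \<open>a\<close>.\<close>
    have "poly p z = g z * poly q z" if "z \<in> cball 0 1" for z
    proof -
      have "g z * poly q z - poly p z = 0"
      proof (rule continuous_constant_on_closure[of unit_disc "\<lambda>z. g z * poly q z - poly p z"])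
        show "continuous_on (closure unit_disc) (\<lambda>z. g z * poly q z - poly p z)"
          using ext by (intro continuous_intros) auto
        show "g z * poly q z - poly p z = 0" if "z \<in> unit_disc" for z
          using that pq eq by auto
      qed (use that in auto)
      then show ?thesis by simp
    qed
    then have "poly p a = 0" using a qa by simp
    then obtain p' where p': "p = [:-a, 1:] * p'" by (metis dvdE poly_eq_0_iff_dvd)
    obtain q' where q': "q = [:-a, 1:] * q'" using qa by (metis dvdE poly_eq_0_iff_dvd)
    have "q \<noteq> 0" using pq(1)[of 0] by auto
    then have "degree q = degree [:-a, 1:] + degree q'"
      unfolding q' by (intro degree_mult_eq) auto
    then have "degree q' < degree q" by simp
    moreover have "P (degree q')"
      unfolding P_def
    proof (rule exI[of _ p'], rule exI[of _ q'], rule conjI[OF refl], rule ballI)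
      fix z :: complex assume z: "z \<in> unit_disc"
      \<comment> \<open>As \<open>q\<close> has no zero in the open disc, z \<noteq> a there and the
        common factor cancels, giving a denominator of smaller degree.\<close>
      have "poly p z = (z - a) * poly p' z" "poly q z = (z - a) * poly q' z"
        by (simp_all add: p' q' algebra_simps)
      with pq(1)[OF z] pq(2)[OF z] show "poly q' z \<noteq> 0 \<and> R z = poly p' z / poly q' z"
        by simp
    qed
    ultimately show False using least not_less_Least by metis
  qed
  with pq(2) show thesis by (rule that[rotated])
qed

section \<open>Difference bounds for holomorphic and univalent maps\<close>

lemma inj_on_difference_bound:
  fixes f :: "complex \<Rightarrow> complex"
  assumes "c > 0" "\<And>z w. z \<in> S \<Longrightarrow> w \<in> S \<Longrightarrow> c * cmod (z - w) \<le> cmod (f z - f w)"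
  shows "inj_on f S"
proof (rule inj_onI)
  fix z w assume "z \<in> S" "w \<in> S" "f z = f w"
  with assms(2)[of z w] have "c * cmod (z - w) \<le> 0" by simp
  with \<open>c > 0\<close> show "z = w" by (simp add: mult_le_0_iff)
qed

text \<open>Mean value inequality for f(z) - f'(a) z, whose derivative is small near
  \<open>a\<close> by continuity of f'.\<close>

lemma holomorphic_linear_approximation:
  assumes f: "f holomorphic_on U" and U: "open U" and a: "a \<in> U" and e: "e > 0"
  obtains \<delta> where "\<delta> > 0" "ball a \<delta> \<subseteq> U"
    "\<And>x y. x \<in> ball a \<delta> \<Longrightarrow> y \<in> ball a \<delta> \<Longrightarrow>
       cmod (f x - f y - deriv f a * (x - y)) \<le> e * cmod (x - y)"
proof -
  have "isCont (deriv f) a"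
    using holomorphic_on_imp_continuous_on[OF holomorphic_deriv[OF f U]] U a
    by (simp add: continuous_on_eq_continuous_at)
  then obtain d1 where d1: "d1 > 0" "\<And>x. dist x a < d1 \<Longrightarrow> dist (deriv f x) (deriv f a) < e"
    using e unfolding continuous_at_eps_delta by blast
  obtain d2 where d2: "d2 > 0" "ball a d2 \<subseteq> U" using U a open_contains_ball by blast
  define \<delta> where "\<delta> = min d1 d2"
  have sub: "ball a \<delta> \<subseteq> U" using d2 by (auto simp: \<delta>_def)
  have "cmod (f x - f y - deriv f a * (x - y)) \<le> e * cmod (x - y)"
    if "x \<in> ball a \<delta>" "y \<in> ball a \<delta>" for x y
  proof -
    have "cmod ((f x - deriv f a * x) - (f y - deriv f a * y)) \<le> e * cmod (x - y)"
    proof (rule field_differentiable_bound[OF convex_ball _ _ that])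
      show "((\<lambda>z. f z - deriv f a * z) has_field_derivative (deriv f z - deriv f a)) (at z within ball a \<delta>)"
        if "z \<in> ball a \<delta>" for z
        using that sub
        by (auto intro!: derivative_eq_intros DERIV_subset[OF holomorphic_derivI[OF f U]])
      show "cmod (deriv f z - deriv f a) \<le> e" if "z \<in> ball a \<delta>" for z
        using d1(2)[of z] that by (simp add: \<delta>_def dist_norm norm_minus_commute)
    qed
    then show ?thesis by (simp add: algebra_simps)
  qed
  with sub d1 d2 show thesis by (intro that[of \<delta>]) (auto simp: \<delta>_def)
qed

text \<open>If no \<open>c\<close> worked, compactness would give pairs (z_n, w_n) with difference
  quotients tending to 0 and a limit (a, b) with f(a) = f(b), so a = b by injectivity. But f'(a)
  \<noteq> 0 for an injective \<open>f\<close>, and near \<open>a\<close> linear approximation keeps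
  the quotients above |f'(a)| / 2.\<close>

lemma univalent_difference_lower_bound:
  assumes f: "f holomorphic_on U" "inj_on f U" and U: "open U" and K: "compact K" "K \<subseteq> U"
  obtains c where "c > 0" "\<And>z w. z \<in> K \<Longrightarrow> w \<in> K \<Longrightarrow> c * cmod (z - w) \<le> cmod (f z - f w)"
proof (rule ccontr)
  assume "\<not> thesis"
  with that have "\<exists>z w. z \<in> K \<and> w \<in> K \<and> cmod (f z - f w) < inverse (real (Suc n)) * cmod (z - w)" for n
    by (metis inverse_positive_iff_positive not_le of_nat_0_less_iff zero_less_Suc)
  then obtain z w where zw: "\<And>n. z n \<in> K" "\<And>n. w n \<in> K"
      "\<And>n. cmod (f (z n) - f (w n)) < inverse (real (Suc n)) * cmod (z n - w n)"
    by metis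
  have "compact (K \<times> K)" using K by (intro compact_Times)
  then obtain l r where lr: "l \<in> K \<times> K" "strict_mono r" "((\<lambda>n. (z n, w n)) \<circ> r) \<longlonglongrightarrow> l"
    unfolding compact_def using zw by (metis (no_types, lifting) SigmaI)
  define a b where "a = fst l" and "b = snd l"
  have ab: "a \<in> K" "b \<in> K" using lr by (auto simp: a_def b_def)
  have za: "(\<lambda>n. z (r n)) \<longlonglongrightarrow> a" using tendsto_fst[OF lr(3)] by (simp add: a_def o_def)
  have wb: "(\<lambda>n. w (r n)) \<longlonglongrightarrow> b" using tendsto_snd[OF lr(3)] by (simp add: b_def o_def)
  have cont: "isCont f x" if "x \<in> K" for x
    using that K U f(1) holomorphic_on_imp_continuous_on continuous_on_eq_continuous_at by blast
  have inv: "(\<lambda>n. inverse (real (Suc (r n)))) \<longlonglongrightarrow> 0"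
    using LIMSEQ_subseq_LIMSEQ[OF LIMSEQ_inverse_real_of_nat lr(2)] by (simp add: o_def)
  have "(\<lambda>n. inverse (real (Suc (r n))) * cmod (z (r n) - w (r n))) \<longlonglongrightarrow> 0 * cmod (a - b)"
    by (intro tendsto_intros inv za wb)
  moreover have "(\<lambda>n. cmod (f (z (r n)) - f (w (r n)))) \<longlonglongrightarrow> cmod (f a - f b)"
    using ab by (intro tendsto_intros isCont_tendsto_compose[OF cont] za wb)
  ultimately have "cmod (f a - f b) \<le> 0 * cmod (a - b)"
    using zw(3) by (intro LIMSEQ_le[of "\<lambda>n. cmod (f (z (r n)) - f (w (r n)))"]) (auto intro: less_imp_le)
  then have "f a = f b" by simp
  then have "a = b" using f(2) ab K by (metis inj_onD subsetD)
  have aU: "a \<in> U" using ab K by auto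
  have d0: "deriv f a \<noteq> 0" using holomorphic_injective_imp_regular[OF f(1) U f(2) aU] .
  have d2: "cmod (deriv f a) / 2 > 0" using d0 by simp
  obtain \<delta> where \<delta>: "\<delta> > 0" "ball a \<delta> \<subseteq> U" and
    approx: "\<And>x y. x \<in> ball a \<delta> \<Longrightarrow> y \<in> ball a \<delta> \<Longrightarrow>
      cmod (f x - f y - deriv f a * (x - y)) \<le> cmod (deriv f a) / 2 * cmod (x - y)"
    by (rule holomorphic_linear_approximation[OF f(1) U aU d2]) (rule that)
  have lower: "cmod (deriv f a) / 2 * cmod (x - y) \<le> cmod (f x - f y)"
    if "x \<in> ball a \<delta>" "y \<in> ball a \<delta>" for x y
    using approx[OF that] norm_triangle_ineq2[of "deriv f a * (x - y)" "f x - f y"]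
    by (simp add: norm_mult norm_minus_commute)
  have "\<forall>\<^sub>F n in sequentially. z (r n) \<in> ball a \<delta>" "\<forall>\<^sub>F n in sequentially. w (r n) \<in> ball a \<delta>"
    using za wb \<open>a = b\<close> \<delta> by (auto simp: tendsto_iff dist_commute)
  moreover have "\<forall>\<^sub>F n in sequentially. inverse (real (Suc (r n))) < cmod (deriv f a) / 2"
    by (rule order_tendstoD(2)[OF inv d2])
  ultimately have "\<forall>\<^sub>F n in sequentially. False"
  proof eventually_elim
    case (elim n)
    have "inverse (real (Suc (r n))) * cmod (z (r n) - w (r n)) \<le> cmod (deriv f a) / 2 * cmod (z (r n) - w (r n))"
      using elim(3) by (intro mult_right_mono) auto
    also have "\<dots> \<le> cmod (f (z (r n)) - f (w (r n)))" by (rule lower[OF elim(1,2)])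
    finally show False using zw(3)[of "r n"] by simp
  qed
  then show False by simp
qed

lemma holomorphic_difference_upper_bound:
  assumes f: "f holomorphic_on U" and U: "open U" and K: "compact K" "convex K" "K \<subseteq> U"
  obtains L where "L \<ge> 0" "\<And>z w. z \<in> K \<Longrightarrow> w \<in> K \<Longrightarrow> cmod (f z - f w) \<le> L * cmod (z - w)"
proof -
  have "continuous_on K (deriv f)"
    by (rule continuous_on_subset[OF holomorphic_on_imp_continuous_on[OF holomorphic_deriv[OF f U]] K(3)])
  then have "bounded (deriv f ` K)"
    using K(1) by (intro compact_imp_bounded compact_continuous_image)
  then obtain L where L: "L > 0" "\<And>z. z \<in> K \<Longrightarrow> cmod (deriv f z) \<le> L"
    unfolding bounded_pos by auto
  have "cmod (f z - f w) \<le> L * cmod (z - w)" if "z \<in> K" "w \<in> K" for z w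
    by (rule field_differentiable_bound[OF K(2) _ L(2) that])
       (use K(3) in \<open>auto intro!: DERIV_subset[OF holomorphic_derivI[OF f U]]\<close>)
  with L(1) show thesis by (intro that[of L]) auto
qed

text \<open>The segment from 1 to \<alpha> could pass through 0 only if \<alpha> were real;
  compactness turns this into a positive bound. This is where the hypothesis that R'(0) is not real
  enters.\<close>

lemma segment_to_nonreal_bounded_below:
  assumes "\<alpha> \<notin> \<real>"
  obtains m where "m > 0" "\<And>t. t \<in> {0..1} \<Longrightarrow> m \<le> cmod ((1 - of_real t) + of_real t * \<alpha>)"
proof -
  have "\<exists>t\<in>{0..1}. \<forall>u\<in>{0..1}. cmod ((1 - of_real t) + of_real t * \<alpha>) \<le> cmod ((1 - of_real u) + of_real u * \<alpha>)"
    by (rule continuous_attains_inf) (auto intro!: continuous_intros)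
  then obtain t :: real where t: "\<And>u. u \<in> {0..1} \<Longrightarrow>
      cmod ((1 - of_real t) + of_real t * \<alpha>) \<le> cmod ((1 - of_real u) + of_real u * \<alpha>)" by blast
  have "(1 - of_real t) + of_real t * \<alpha> \<noteq> 0"
  proof
    assume 0: "(1 - of_real t) + of_real t * \<alpha> = 0"
    have "Im \<alpha> \<noteq> 0" using assms by (simp add: complex_is_Real_iff)
    with arg_cong[OF 0, of Im] have "t = 0" by simp
    with 0 show False by simp
  qed
  with t show thesis by (intro that[of "cmod ((1 - of_real t) + of_real t * \<alpha>)"]) auto
qed

section \<open>Injectivity along the straight line\<close>

lemma straight_line_diff:
  "straight_line R t z - straight_line R t w = (1 - of_real t) * (z - w) + of_real t * (R z - R w)"
  by (simp add: straight_line_def algebra_simps)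

lemma continuous_on_rescaled_straight_line:
  assumes k: "continuous_on T k" and R: "continuous_on S R"
    and kz: "\<And>t z. t \<in> T \<Longrightarrow> z \<in> S \<Longrightarrow> of_real (k t) * z \<in> S"
  shows "continuous_on (T \<times> S) (\<lambda>(t, z). straight_line R t (of_real (k t) * z))"
proof -
  have t: "continuous_on (T \<times> S) (\<lambda>x. complex_of_real (fst x))"
    by (rule continuous_on_of_real[OF continuous_on_fst[OF continuous_on_id]])
  have "continuous_on (T \<times> S) (\<lambda>x. k (fst x))"
    by (rule continuous_on_compose2[OF k continuous_on_fst[OF continuous_on_id]]) auto
  then have scaled: "continuous_on (T \<times> S) (\<lambda>x. of_real (k (fst x)) * snd x)"
    by (rule continuous_on_mult[OF continuous_on_of_real continuous_on_snd[OF continuous_on_id]])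
  have "(\<lambda>x. of_real (k (fst x)) * snd x) ` (T \<times> S) \<subseteq> S"
    using kz by auto
  then have Rs: "continuous_on (T \<times> S) (\<lambda>x. R (of_real (k (fst x)) * snd x))"
    by (rule continuous_on_compose2[OF R scaled])
  show ?thesis
    unfolding straight_line_def case_prod_beta
    by (rule continuous_on_add[OF continuous_on_mult[OF continuous_on_diff[OF continuous_on_const t] scaled]
          continuous_on_mult[OF t Rs]])
qed

text \<open>A perturbation of the identity: f_t = id - t (id - R), where id - R has Lipschitz
  constant 1 + L. The bound on \<open>t\<close> leaves at least half of |z - w|.\<close>

lemma inj_on_straight_line_near_0:
  assumes L: "L \<ge> 0" "\<And>z w. z \<in> S \<Longrightarrow> w \<in> S \<Longrightarrow> cmod (R z - R w) \<le> L * cmod (z - w)"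
    and t: "0 \<le> t" "t * (1 + L) \<le> 1 / 2"
  shows "inj_on (straight_line R t) S"
proof (rule inj_on_difference_bound[of "1 / 2"])
  fix z w assume zw: "z \<in> S" "w \<in> S"
  let ?d = "cmod (z - w)"
  have "straight_line R t z - straight_line R t w = (z - w) - of_real t * ((z - w) - (R z - R w))"
    by (simp add: straight_line_diff algebra_simps)
  moreover have "cmod (of_real t * ((z - w) - (R z - R w))) \<le> t * ((1 + L) * ?d)"
  proof -
    have "cmod ((z - w) - (R z - R w)) \<le> (1 + L) * ?d"
      using L(2)[OF zw] norm_triangle_ineq4[of "z - w" "R z - R w"] by (simp add: algebra_simps)
    then show ?thesis using t(1) by (simp add: norm_mult mult_left_mono)
  qed
  moreover have "t * ((1 + L) * ?d) \<le> 1 / 2 * ?d"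
    using mult_right_mono[OF t(2), of ?d] by (simp add: mult.assoc)
  ultimately show "1 / 2 * ?d \<le> cmod (straight_line R t z - straight_line R t w)"
    using norm_triangle_ineq2[of "z - w" "of_real t * ((z - w) - (R z - R w))"] by simp
qed simp

text \<open>A perturbation of \<open>R\<close>: differences of f_t are at least t c - (1 - t) = c -
  (1 - t) (1 + c) times |z - w|, which the bound on \<open>t\<close> keeps at c/2 or more.\<close>

lemma inj_on_straight_line_near_1:
  assumes c: "c > 0" "\<And>z w. z \<in> S \<Longrightarrow> w \<in> S \<Longrightarrow> c * cmod (z - w) \<le> cmod (R z - R w)"
    and t: "0 \<le> t" "t \<le> 1" "(1 - t) * (1 + c) \<le> c / 2"
  shows "inj_on (straight_line R t) S"
proof (rule inj_on_difference_bound[of "c / 2"])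
  fix z w assume zw: "z \<in> S" "w \<in> S"
  let ?d = "cmod (z - w)"
  have "t * (c * ?d) \<le> cmod (of_real t * (R z - R w))"
    using c(2)[OF zw] t by (simp add: norm_mult mult_left_mono)
  moreover have "cmod ((1 - of_real t) * (z - w)) = (1 - t) * ?d"
  proof -
    have "1 - complex_of_real t = of_real (1 - t)" by simp
    then show ?thesis using t by (simp add: norm_mult del: of_real_diff)
  qed
  moreover have "(1 - t) * (1 + c) * ?d \<le> c / 2 * ?d"
    using t by (intro mult_right_mono) auto
  moreover have "cmod (of_real t * (R z - R w)) - cmod ((1 - of_real t) * (z - w)) \<le>
      cmod (straight_line R t z - straight_line R t w)"
    unfolding straight_line_diff by (subst add.commute) (rule norm_diff_ineq)
  ultimately show "c / 2 * ?d \<le> cmod (straight_line R t z - straight_line R t w)"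
    by (simp add: algebra_simps)
qed (use c in simp)

text \<open>Here f_t is a linear map with slope of modulus at least \<open>m\<close>, plus an error
  with Lipschitz constant at most m/2.\<close>

lemma inj_on_straight_line_small:
  assumes m: "m > 0" "m \<le> cmod ((1 - of_real t) + of_real t * \<alpha>)"
    and approx: "\<And>z w. z \<in> S \<Longrightarrow> w \<in> S \<Longrightarrow> cmod (R z - R w - \<alpha> * (z - w)) \<le> m / 2 * cmod (z - w)"
    and t: "0 \<le> t" "t \<le> 1"
  shows "inj_on (straight_line R t) S"
proof (rule inj_on_difference_bound[of "m / 2"])
  fix z w assume zw: "z \<in> S" "w \<in> S"
  let ?d = "cmod (z - w)"
  let ?e = "of_real t * (R z - R w - \<alpha> * (z - w))"
  have "straight_line R t z - straight_line R t w = ((1 - of_real t) + of_real t * \<alpha>) * (z - w) + ?e"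
    by (simp add: straight_line_diff algebra_simps)
  moreover have "m * ?d \<le> cmod (((1 - of_real t) + of_real t * \<alpha>) * (z - w))"
    using m unfolding norm_mult by (intro mult_right_mono) auto
  moreover have "cmod ?e \<le> 1 * (m / 2 * ?d)"
    unfolding norm_mult using approx[OF zw] t m(1) by (intro mult_mono) auto
  ultimately show "m / 2 * ?d \<le> cmod (straight_line R t z - straight_line R t w)"
    using norm_diff_ineq[of "((1 - of_real t) + of_real t * \<alpha>) * (z - w)" ?e] by simp
qed (use m in simp)

text \<open>The rescaled map is rational, with \<open>q\<close> composed with z \<mapsto> k z as
  common denominator. As k \<le> 1, the scaling maps the closed disc into itself, so no pole appears
  there.\<close>

lemma quadrature_domain_rescaled_straight_line:
  fixes p q :: "complex poly"
  assumes q: "\<And>z. z \<in> cball 0 1 \<Longrightarrow> poly q z \<noteq> 0"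
    and pq: "\<And>z. z \<in> unit_disc \<Longrightarrow> R z = poly p z / poly q z"
    and k: "0 \<le> k" "k \<le> 1"
    and inj: "inj_on (\<lambda>z. straight_line R t (of_real k * z)) unit_disc"
  shows "quadrature_domain ((\<lambda>z. straight_line R t (of_real k * z)) ` unit_disc)"
proof -
  define l where "l = [:0, complex_of_real k:]"
  define P where "P = smult (1 - of_real t) (l * pcompose q l) + smult (of_real t) (pcompose p l)"
  have l: "poly l z = of_real k * z" for z by (simp add: l_def)
  have kz: "cmod (of_real k * z) \<le> cmod z" for z
    using k by (simp add: norm_mult mult_left_le_one_le)
  have Q: "poly (pcompose q l) z \<noteq> 0" if "z \<in> cball 0 1" for z
    unfolding poly_pcompose l using that by (intro q) (simp only: mem_cball_0 order_trans[OF kz])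
  have eq: "straight_line R t (of_real k * z) = poly P z / poly (pcompose q l) z"
    if z: "z \<in> unit_disc" for z
  proof -
    have "of_real k * z \<in> unit_disc"
      using z kz[of z] by (simp only: mem_ball_0 le_less_trans)
    from pq[OF this] Q[of z] z show ?thesis
      by (simp add: straight_line_def P_def poly_pcompose l add_divide_distrib)
  qed
  have "quadrature_domain ((\<lambda>z. poly P z / poly (pcompose q l) z) ` unit_disc)"
    using Q
  proof (rule quadrature_domain_rational_image)
    show "inj_on (\<lambda>z. poly P z / poly (pcompose q l) z) unit_disc"
      using inj by (rule inj_on_cong[THEN iffD1, rotated]) (rule eq)
  qed
  also have "(\<lambda>z. poly P z / poly (pcompose q l) z) ` unit_disc = (\<lambda>z. straight_line R t (of_real k * z)) ` unit_disc"
    by (rule image_cong[OF refl]) (rule eq[symmetric])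
  finally show ?thesis .
qed

theorem proposition6p2:
  fixes \<Omega> :: "complex set" and R :: "complex \<Rightarrow> complex"
  assumes "bounded \<Omega>" and "simply_connected \<Omega>" and "quadrature_domain \<Omega>"
    and "rational_on R unit_disc" and "biholomorphic R unit_disc \<Omega>"
    and "extends_univalently_near R unit_disc (closure unit_disc)"
    and "deriv R 0 \<notin> \<real>"
  shows "\<exists>\<phi> :: real \<Rightarrow> complex \<Rightarrow> complex.
           homotopy_between unit_disc \<phi> (\<lambda>z. z) R \<and>
           (\<forall>t\<in>{0..1}. univalent_on (\<phi> t) unit_disc \<and> quadrature_domain (\<phi> t ` unit_disc)) \<and>
           rescaling_of_straight_line R \<phi>"
proof -
  have holR: "R holomorphic_on unit_disc"
    using assms(5) by (simp add: biholomorphic_def)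
  obtain U g where U: "open U" "cball 0 1 \<subseteq> U" and g: "g holomorphic_on U" "inj_on g U"
    and gR: "\<And>z. z \<in> unit_disc \<Longrightarrow> g z = R z"
    using assms(6) by (auto simp: extends_univalently_near_def univalent_on_def)
  have gc: "continuous_on (cball 0 1) g"
    by (rule continuous_on_subset[OF holomorphic_on_imp_continuous_on[OF g(1)] U(2)])
  obtain p q :: "complex poly" where q: "\<And>z. z \<in> cball 0 1 \<Longrightarrow> poly q z \<noteq> 0"
    and pq: "\<And>z. z \<in> unit_disc \<Longrightarrow> R z = poly p z / poly q z"
    using assms(4) gc gR by (rule rational_on_closed_disc) (auto intro: that)
  obtain c where c: "c > 0"
    "\<And>z w. z \<in> cball 0 1 \<Longrightarrow> w \<in> cball 0 1 \<Longrightarrow> c * cmod (z - w) \<le> cmod (g z - g w)"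
    using g U(1) compact_cball U(2) by (rule univalent_difference_lower_bound) (rule that)
  have cR: "c * cmod (z - w) \<le> cmod (R z - R w)" if "z \<in> unit_disc" "w \<in> unit_disc" for z w
    using c(2)[of z w] that by (simp add: gR)
  obtain L where L: "L \<ge> 0"
    "\<And>z w. z \<in> cball 0 1 \<Longrightarrow> w \<in> cball 0 1 \<Longrightarrow> cmod (g z - g w) \<le> L * cmod (z - w)"
    using g(1) U(1) compact_cball convex_cball U(2) by (rule holomorphic_difference_upper_bound) (rule that)
  have LR: "cmod (R z - R w) \<le> L * cmod (z - w)" if "z \<in> unit_disc" "w \<in> unit_disc" for z w
    using L(2)[of z w] that by (simp add: gR)
  obtain m where m: "m > 0"
    "\<And>t. t \<in> {0..1} \<Longrightarrow> m \<le> cmod ((1 - of_real t) + of_real t * deriv R 0)"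
    using assms(7) by (rule segment_to_nonreal_bounded_below) (rule that)
  have "m / 2 > 0" using m(1) by simp
  \<comment> \<open>The precision m/2 is half the lower bound on |f_t'(0)|, so one radius serves
    every \<open>t\<close>.\<close>
  obtain r where r: "r > 0" "ball 0 r \<subseteq> unit_disc"
    "\<And>z w. z \<in> ball 0 r \<Longrightarrow> w \<in> ball 0 r \<Longrightarrow> cmod (R z - R w - deriv R 0 * (z - w)) \<le> m / 2 * cmod (z - w)"
    by (rule holomorphic_linear_approximation[OF holR open_ball _ \<open>m / 2 > 0\<close>, of 0]) (simp, rule that)
  have "r \<le> 1" using r(1,2) by (simp add: ball_subset_ball_iff)
  \<comment> \<open>Small enough for the perturbation arguments at both ends: the first entry serves
    t near 0, the second t near 1.\<close>
  define \<epsilon> where "\<epsilon> = min (1 / (2 * (1 + L))) (c / (2 * (1 + c)))"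
  have \<epsilon>: "\<epsilon> > 0" "\<epsilon> * (1 + L) \<le> 1 / 2" "\<epsilon> * (1 + c) \<le> c / 2"
  proof -
    show "\<epsilon> > 0" using L(1) c(1) by (simp add: \<epsilon>_def)
    have "\<epsilon> \<le> 1 / (2 * (1 + L))" "\<epsilon> \<le> c / (2 * (1 + c))" by (simp_all add: \<epsilon>_def)
    then show "\<epsilon> * (1 + L) \<le> 1 / 2" "\<epsilon> * (1 + c) \<le> c / 2"
      using L(1) c(1) by (simp_all add: field_simps)
  qed
  \<comment> \<open>Two linear ramps, falling from 1 to 0 over length \<epsilon> from either end,
    cut off below at \<open>r\<close>. Thus \<open>k\<close> is 1 at both ends and \<open>r\<close>
    wherever \<open>t\<close> and 1 - t are both at least \<epsilon>.\<close>
  define k where "k = (\<lambda>t::real. max r (max (1 - t / \<epsilon>) (1 - (1 - t) / \<epsilon>)))"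
  have kc: "continuous_on {0..1} k"
    unfolding k_def by (intro continuous_intros) (use \<epsilon> in auto)
  have k_range: "0 < k t" "k t \<le> 1" if "t \<in> {0..1}" for t
    using that r(1) \<open>r \<le> 1\<close> \<epsilon>(1) by (auto simp: k_def)
  have k01: "k 0 = 1" "k 1 = 1"
    using \<open>r \<le> 1\<close> \<epsilon>(1) by (auto simp: k_def max_def)
  have inj: "inj_on (straight_line R t) (ball 0 (k t))" if t: "t \<in> {0..1}" for t
  proof -
    have sub: "ball 0 (k t) \<subseteq> unit_disc" using k_range(2)[OF t] by (simp add: subset_ball)
    \<comment> \<open>Within \<epsilon> of an end f_t is injective on the whole disc, whatever the
      value of \<open>k\<close>; only in the middle does the smaller radius \<open>r\<close>
      matter.\<close>
    consider "t \<le> \<epsilon>" | "1 - t \<le> \<epsilon>" | "\<epsilon> < t" "\<epsilon> < 1 - t" by linarith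
    then show ?thesis
    proof cases
      case 1
      then have "t * (1 + L) \<le> 1 / 2"
        using \<epsilon>(2) L(1) by (meson add_nonneg_nonneg mult_right_mono order_trans zero_le_one)
      then have "inj_on (straight_line R t) unit_disc"
        using t by (intro inj_on_straight_line_near_0[OF L(1) LR]) auto
      then show ?thesis using sub by (rule inj_on_subset)
    next
      case 2
      then have "(1 - t) * (1 + c) \<le> c / 2"
        using \<epsilon>(3) c(1) by (meson add_nonneg_nonneg less_imp_le mult_right_mono order_trans zero_le_one)
      then have "inj_on (straight_line R t) unit_disc"
        using t by (intro inj_on_straight_line_near_1[OF c(1) cR]) auto
      then show ?thesis using sub by (rule inj_on_subset)
    next
      case 3
      then have "1 - t / \<epsilon> < 0" "1 - (1 - t) / \<epsilon> < 0" using \<epsilon>(1) by (auto simp: field_simps)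
      then have "k t = r" using r(1) by (simp add: k_def)
      then show ?thesis
        using t by (simp only:) (intro inj_on_straight_line_small[OF m(1) m(2) r(3)], auto)
    qed
  qed
  define \<phi> where "\<phi> = (\<lambda>t z. straight_line R t (of_real (k t) * z))"
  have kz: "cmod (of_real (k t) * z) < k t" if "t \<in> {0..1}" "z \<in> unit_disc" for t z
  proof -
    have "k t * cmod z < k t * 1"
      using that k_range(1)[of t] by (intro mult_strict_left_mono) auto
    then show ?thesis using k_range(1)[OF that(1)] by (simp add: norm_mult)
  qed
  have kz1: "of_real (k t) * z \<in> unit_disc" if "t \<in> {0..1}" "z \<in> unit_disc" for t z
    unfolding mem_ball_0 using kz[OF that] k_range(2)[OF that(1)] by (rule less_le_trans)
  have Rc: "continuous_on unit_disc R" using holR by (rule holomorphic_on_imp_continuous_on)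
  have \<phi>c: "continuous_on ({0..1} \<times> unit_disc) (\<lambda>(t, z). \<phi> t z)"
    unfolding \<phi>_def using kc Rc kz1 by (rule continuous_on_rescaled_straight_line)
  have \<phi>01: "\<phi> 0 z = z" "\<phi> 1 z = R z" for z
    unfolding \<phi>_def straight_line_def k01 by simp_all
  have "homotopy_between unit_disc \<phi> (\<lambda>z. z) R"
    unfolding homotopy_between_def by (intro conjI ballI \<phi>c \<phi>01)
  moreover have "univalent_on (\<phi> t) unit_disc \<and> quadrature_domain (\<phi> t ` unit_disc)" if t: "t \<in> {0..1}" for t
  proof -
    have inj\<phi>: "inj_on (\<phi> t) unit_disc"
    proof (rule inj_onI)
      fix z w assume zw: "z \<in> unit_disc" "w \<in> unit_disc" "\<phi> t z = \<phi> t w"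
      have "complex_of_real (k t) * z = of_real (k t) * w"
      proof (rule inj_onD[OF inj[OF t]])
        show "straight_line R t (of_real (k t) * z) = straight_line R t (of_real (k t) * w)"
          using zw(3) unfolding \<phi>_def .
      qed (unfold mem_ball_0, rule kz[OF t zw(1)], rule kz[OF t zw(2)])
      then show "z = w" using k_range(1)[OF t] by simp
    qed
    have "(\<lambda>z. R (of_real (k t) * z)) holomorphic_on unit_disc"
      using holomorphic_on_compose_gen[of "\<lambda>z. of_real (k t) * z" unit_disc R unit_disc,
          OF _ holR image_subsetI[OF kz1[OF t]]]
      unfolding o_def by (simp only: holomorphic_on_mult holomorphic_on_const holomorphic_on_ident)
    then have "\<phi> t holomorphic_on unit_disc"
      unfolding \<phi>_def straight_line_def by (intro holomorphic_intros)
    then have "univalent_on (\<phi> t) unit_disc" using inj\<phi> unfolding univalent_on_def by (rule conjI)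
    moreover have "quadrature_domain (\<phi> t ` unit_disc)"
      using q pq less_imp_le[OF k_range(1)[OF t]] k_range(2)[OF t] inj\<phi>
      unfolding \<phi>_def by (rule quadrature_domain_rescaled_straight_line)
    ultimately show ?thesis by (rule conjI)
  qed
  moreover have "rescaling_of_straight_line R \<phi>"
    unfolding rescaling_of_straight_line_def \<phi>_def
    using kc k_range by (intro exI[of _ k] conjI ballI refl image_subsetI) simp_all
  ultimately show ?thesis by blast
qed

end
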